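(* Let $n\ge 1$, $d>0$, let $k:\mathbb R^n\to\mathbb R$ satisfy $k\in C(\mathbb R^n)\cap L^\infty(\mathbb R^n)$, $k\ge 0$, $k(0)>0$, $\int_{\mathbb R^n}k(x)\,dx=1$. Let $\Omega_0$ be a smooth bounded domain in $\mathbb R^n$, $\ell_0>0$ a constant, and let $\gamma_0\in L^\infty(\mathbb R^n)$ satisfy $\gamma_0(x)=-\ell_0$ for $x\in\mathbb R^n\setminus\bar\Omega_0$, $\gamma_0|_{\bar\Omega_0}\ge 0$ and $\gamma_0|_{\bar\Omega_0}\not\equiv 0$. Then the problem $$\begin{cases}\displaystyle \gamma_t(t,x)=d\int_{\{\gamma>0\}}k(x-y)\gamma(t,y)\,dy-d\,\gamma(t,x)\chi_{\{\gamma>0\}}, & t>0,\ x\in\mathbb R^n,\\ \gamma(0,x)=\gamma_0(x), & x\in\mathbb R^n,\end{cases}$$ admits a unique classical solution $\gamma(t,\cdot)\in L^\infty(\mathbb R^n)$ defined for all $t>0$, and $\gamma$ satisfies $$\operatorname{ess\,inf}_{\mathbb R^n}\gamma_0\le\gamma(t,x)\le\operatorname{ess\,sup}_{\mathbb R^n}\gamma_0\qquad\text{for } t>0,\ x\in\mathbb R^n.$$ Moreover, if $\gamma_0|_{\bar\Omega_0}\in C(\bar\Omega_0)$, then for any $t>0$ the function $\gamma(t,\cdot)$ is continuous in $\bar\Omega_0$ and in $\mathbb R^n\setminus\bar\Omega_0$.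
   Context: $\chi_E$ is the characteristic function of $E$; $\{\gamma>0\}$ at time $t$ means $\{y\in\mathbb R^n:\gamma(t,y)>0\}$. A classical solution on $[0,\infty)$ is a function $\gamma\in C([0,\infty);L^\infty(\mathbb R^n))$ with $\gamma(0,\cdot)=\gamma_0$ satisfying, for $t>0$ and $x\in\mathbb R^n$, $$\gamma(t,x)=\gamma_0(x)+d\int_0^t\int_{\{\gamma(\tau,\cdot)>0\}}k(x-y)\gamma(\tau,y)\,dy\,d\tau-d\int_0^t\gamma(\tau,x)\chi_{\{\gamma>0\}}(\tau,x)\,d\tau,$$ so that $\gamma$ is differentiable in $t$ and satisfies the differential equation. Relations between $L^\infty$ functions of $x$ are understood for almost every $x$; continuity in $\bar\Omega_0$ and in $\mathbb R^n\setminus\bar\Omega_0$ means continuity of the restrictions to each of these sets (for the representative given by the integral equation). *)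

theory Defs
  imports "HOL-Analysis.Analysis" "HOL-Probability.Essential_Supremum"
begin

subsection \<open>Smooth bounded domains\<close>

text \<open>
  Continuous differentiability of order m, to be used on open sets: iterated directional
  derivatives in arbitrary directions exist and are continuous.
\<close>

primrec Cm_on :: "nat \<Rightarrow> 'a::euclidean_space set \<Rightarrow> ('a \<Rightarrow> real) \<Rightarrow> bool" where
  "Cm_on 0 U f \<longleftrightarrow> continuous_on U f"
| "Cm_on (Suc m) U f \<longleftrightarrow>
     (\<forall>x\<in>U. f differentiable (at x)) \<and>
     (\<forall>v. Cm_on m U (\<lambda>x. frechet_derivative f (at x) v))"

definition smooth_on :: "'a::euclidean_space set \<Rightarrow> ('a \<Rightarrow> real) \<Rightarrow> bool" where
  "smooth_on U f \<longleftrightarrow> (\<forall>m. Cm_on m U f)"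

text \<open>
  The boundary is smooth in the sense of local defining functions: near each boundary point
  the set lies strictly on one side of a regular level set of a smooth function.
\<close>

definition smooth_boundary :: "'a::euclidean_space set \<Rightarrow> bool" where
  "smooth_boundary \<Omega> \<longleftrightarrow>
     (\<forall>p\<in>frontier \<Omega>. \<exists>U \<rho>. open U \<and> p \<in> U \<and> smooth_on U \<rho> \<and>
        frechet_derivative \<rho> (at p) \<noteq> (\<lambda>v. 0) \<and>
        \<Omega> \<inter> U = {x \<in> U. \<rho> x < 0})"

definition smooth_bounded_domain :: "'a::euclidean_space set \<Rightarrow> bool" where
  "smooth_bounded_domain \<Omega> \<longleftrightarrow>
     open \<Omega> \<and> connected \<Omega> \<and> \<Omega> \<noteq> {} \<and> bounded \<Omega> \<and> smooth_boundary \<Omega>"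

subsection \<open>Essentially bounded functions\<close>

text \<open>
  Elements of L-infinity are represented by Lebesgue measurable functions; equality in
  L-infinity is equality almost everywhere.
\<close>

definition essinf :: "'a measure \<Rightarrow> ('a \<Rightarrow> ereal) \<Rightarrow> ereal" where
  "essinf M f = - esssup M (\<lambda>x. - f x)"

definition Linfty_norm :: "('a::euclidean_space \<Rightarrow> real) \<Rightarrow> ereal" where
  "Linfty_norm f = esssup lebesgue (\<lambda>x. ereal \<bar>f x\<bar>)"

definition Linfty :: "('a::euclidean_space \<Rightarrow> real) set" where
  "Linfty = {f \<in> borel_measurable lebesgue. Linfty_norm f < \<infinity>}"

text \<open>
  The curve \<open>t \<mapsto> \<gamma> t\<close> is a continuous map from the half-line into L-infinity.
  Joint measurability only fixes the choice of representatives: every continuous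
  L-infinity-valued curve has a jointly measurable one, and by Fubini the integral over time
  of \<open>\<gamma> \<tau> x\<close> at fixed \<open>x\<close> does not depend on the choice, up to a null set of \<open>x\<close>.
  Without it these pointwise integrals would not be determined by the classes.
\<close>

definition continuous_Linfty_curve :: "(real \<Rightarrow> 'a::euclidean_space \<Rightarrow> real) \<Rightarrow> bool" where
  "continuous_Linfty_curve \<gamma> \<longleftrightarrow>
     (\<forall>t\<ge>0. \<gamma> t \<in> Linfty) \<and>
     (\<forall>t\<ge>0. ((\<lambda>s. Linfty_norm (\<lambda>x. \<gamma> s x - \<gamma> t x)) \<longlongrightarrow> 0) (at t within {0..})) \<and>
     case_prod \<gamma> \<in> borel_measurable (lebesgue_on ({0..} \<times> UNIV))"

subsection \<open>The nonlocal problem\<close>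

definition integral_equation_at ::
    "real \<Rightarrow> ('a::euclidean_space \<Rightarrow> real) \<Rightarrow> ('a \<Rightarrow> real) \<Rightarrow> (real \<Rightarrow> 'a \<Rightarrow> real) \<Rightarrow> real \<Rightarrow> 'a \<Rightarrow> bool"
  where
  "integral_equation_at d k \<gamma>0 \<gamma> t x \<longleftrightarrow>
     \<gamma> t x = \<gamma>0 x
       + d * (LINT \<tau>:{0..t}|lebesgue. (LINT y:{y. \<gamma> \<tau> y > 0}|lebesgue. k (x - y) * \<gamma> \<tau> y))
       - d * (LINT \<tau>:{0..t}|lebesgue. \<gamma> \<tau> x * indicat_real {y. \<gamma> \<tau> y > 0} x)"

definition classical_solution ::
    "real \<Rightarrow> ('a::euclidean_space \<Rightarrow> real) \<Rightarrow> ('a \<Rightarrow> real) \<Rightarrow> (real \<Rightarrow> 'a \<Rightarrow> real) \<Rightarrow> bool"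
  where
  "classical_solution d k \<gamma>0 \<gamma> \<longleftrightarrow>
     continuous_Linfty_curve \<gamma> \<and>
     (AE x in lebesgue. \<gamma> 0 x = \<gamma>0 x) \<and>
     (\<forall>t>0. AE x in lebesgue. integral_equation_at d k \<gamma>0 \<gamma> t x)"

text \<open>
  The representative given by the integral equation, for pointwise defined initial data:
  the equation holds at every \<open>x\<close>. Continuity in time makes the time integral at each
  single \<open>x\<close> a genuine integral rather than the default value of a divergent one.
\<close>

definition pointwise_solution ::
    "real \<Rightarrow> ('a::euclidean_space \<Rightarrow> real) \<Rightarrow> ('a \<Rightarrow> real) \<Rightarrow> (real \<Rightarrow> 'a \<Rightarrow> real) \<Rightarrow> bool"
  where
  "pointwise_solution d k \<gamma>0 \<gamma> \<longleftrightarrow>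
     (\<forall>x. \<gamma> 0 x = \<gamma>0 x) \<and>
     (\<forall>x. continuous_on {0..} (\<lambda>t. \<gamma> t x)) \<and>
     (\<forall>t>0. \<forall>x. integral_equation_at d k \<gamma>0 \<gamma> t x)"

end

theory Submission
  imports Defs
begin

text \<open>
  Write \<open>u\<^sup>+ = max 0 u\<close>. Since \<open>u \<chi>\<close> over the set \<open>u > 0\<close> is \<open>u\<^sup>+\<close>, the problem
  is the ordinary differential equation \<open>u' = d (k * u\<^sup>+ - u\<^sup>+)\<close> with a globally Lipschitz right-hand
  side: the free boundary has disappeared. Adding \<open>d u\<close> to both sides gives
  \<open>u' + d u = d R u\<close> with \<open>R u = k * u\<^sup>+ + min 0 u\<close> (the constant \<open>reaction\<close>). As \<open>k\<close> is
  nonnegative with mass one, \<open>R\<close> is \<open>2\<close>-Lipschitz for the sup norm, and it maps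
  functions with values in \<open>[m, M]\<close> to such functions whenever \<open>m \<le> 0 \<le> M\<close>.

  The variation-of-constants form \<open>u t = e\<^sup>-\<^sup>d\<^sup>t (h + \<integral>\<^sub>0\<^sup>t d e\<^sup>d\<^sup>s R (u s) ds)\<close> exhibits \<open>u t\<close>
  as an average of the datum \<open>h\<close> and of values of \<open>R\<close>. So the map that it defines
  keeps the bounds \<open>[m, M]\<close> (\<open>duhamel_bounds\<close>), and the maximum principle
  needs no argument of its own. The same map halves distances measured with the weight
  \<open>e\<^sup>4\<^sup>d\<^sup>t\<close> (\<open>duhamel_contraction\<close>), so the Picard iterates converge on the whole half-line, geometrically and
  locally uniformly in time (\<open>duhamel_fixed_point\<close>). Everything is done with genuine functions that are
  jointly Borel, so the limit satisfies the differential equation at every point.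

  The iterates also inherit continuity in space on every set on which the datum is continuous:
  the convolution of \<open>k\<close> with a bounded function is continuous because translations
  of \<open>k\<close> are continuous in \<open>L\<^sup>1\<close>, by Scheffe's lemma.

  For uniqueness, a competing solution is only an \<open>L\<^sup>\<infinity>\<close>-valued curve. The halving
  estimate with the weight \<open>e\<^sup>4\<^sup>d\<^sup>t\<close> survives when bounds hold almost everywhere in each time slice,
  because Fubini turns them into bounds at almost every time above almost every point
  (\<open>classical_solution_contraction\<close>). A curve that is continuous into \<open>L\<^sup>\<infinity>\<close> is bounded on compact time
  intervals, so the estimate can be started, and iterating it gives equality. Uniqueness also identifies
  the solution from an arbitrary representative of the datum with the one from the
  representative that is continuous on the closed domain and constant outside.
\<close>

section \<open>Integration and geometric limits\<close>

lemma integral_abs_AE_bound: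
  fixes f g :: "'a \<Rightarrow> real"
  assumes "integrable M f" "integrable M g" "AE x in M. \<bar>f x\<bar> \<le> g x"
  shows "\<bar>LINT x|M. f x\<bar> \<le> (LINT x|M. g x)"
proof -
  have "\<bar>LINT x|M. f x\<bar> \<le> (LINT x|M. \<bar>f x\<bar>)"
    by (rule integral_abs_bound)
  also have "\<dots> \<le> (LINT x|M. g x)"
    using assms by (intro integral_mono_AE) auto
  finally show ?thesis .
qed

lemma set_integral_abs_AE_bound:
  fixes f g :: "'a \<Rightarrow> real"
  assumes "set_integrable M A f" "set_integrable M A g"
    and "AE x in M. x \<in> A \<longrightarrow> \<bar>f x\<bar> \<le> g x"
  shows "\<bar>LINT x:A|M. f x\<bar> \<le> (LINT x:A|M. g x)"
  unfolding set_lebesgue_integral_def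
proof (rule integral_abs_AE_bound)
  show "AE x in M. \<bar>indicator A x *\<^sub>R f x\<bar> \<le> indicator A x *\<^sub>R g x"
    using assms(3) by eventually_elim (auto simp: indicator_def)
qed (use assms in \<open>auto simp: set_integrable_def\<close>)

lemma set_integrable_bounded_Icc:
  fixes f :: "real \<Rightarrow> real"
  assumes [measurable]: "f \<in> borel_measurable borel"
    and "AE s in lborel. s \<in> {a..b} \<longrightarrow> \<bar>f s\<bar> \<le> B"
  shows "set_integrable lborel {a..b} f"
  unfolding set_integrable_def
proof (rule Bochner_Integration.integrable_bound)
  show "integrable lborel (\<lambda>s. indicator {a..b} s * B :: real)"
    by (simp add: emeasure_lborel_Icc_eq)
  show "AE s in lborel. norm (indicator {a..b} s *\<^sub>R f s) \<le> norm (indicator {a..b} s * B)"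
    using assms(2) by eventually_elim (auto simp: indicator_def)
qed measurable

lemma exp_integral_Icc:
  fixes a c t :: real
  assumes "a \<noteq> 0" "0 \<le> t"
  shows "set_integrable lborel {0..t} (\<lambda>s. c * exp (a * s))"
    and "(LBINT s:{0..t}. c * exp (a * s)) = c * (exp (a * t) - 1) / a"
proof -
  have "has_bochner_integral lborel (\<lambda>s. (c * exp (a * s)) * indicator {0..t} s)
      (c * exp (a * t) / a - c * exp (a * 0) / a)"
    by (rule has_bochner_integral_FTC_Icc_real[OF \<open>0 \<le> t\<close>])
      (auto intro!: derivative_eq_intros continuous_intros simp: assms)
  moreover have "(\<lambda>s. (c * exp (a * s)) * indicator {0..t} s)
      = (\<lambda>s. indicator {0..t} s *\<^sub>R (c * exp (a * s)))"
    by (simp add: fun_eq_iff)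
  ultimately show "set_integrable lborel {0..t} (\<lambda>s. c * exp (a * s))"
    and "(LBINT s:{0..t}. c * exp (a * s)) = c * (exp (a * t) - 1) / a"
    unfolding set_integrable_def set_lebesgue_integral_def
    by (simp_all add: has_bochner_integral_iff right_diff_distrib diff_divide_distrib)
qed

lemma geometric_Cauchy_limit:
  fixes a :: "nat \<Rightarrow> real"
  assumes "\<And>n. \<bar>a (Suc n) - a n\<bar> \<le> c / 2 ^ n"
  shows "\<exists>l. a \<longlonglongrightarrow> l \<and> (\<forall>n. \<bar>l - a n\<bar> \<le> 2 * c / 2 ^ n)"
proof -
  have step: "\<bar>a (n + j) - a n\<bar> \<le> 2 * c / 2 ^ n - 2 * c / 2 ^ (n + j)" for n j
  proof (induction j)
    case (Suc j)
    have "\<bar>a (n + Suc j) - a n\<bar> \<le> c / 2 ^ (n + j) + (2 * c / 2 ^ n - 2 * c / 2 ^ (n + j))"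
      using assms[of "n + j"] Suc by simp
    then show ?case by (simp add: field_simps)
  qed simp
  have c: "0 \<le> c" using assms[of 0] by simp
  have bound: "\<bar>a j - a n\<bar> \<le> 2 * c / 2 ^ n" if "n \<le> j" for n j
  proof -
    have "\<bar>a j - a n\<bar> \<le> 2 * c / 2 ^ n - 2 * c / 2 ^ j"
      using step[of n "j - n"] that by simp
    also have "\<dots> \<le> 2 * c / 2 ^ n" using c by simp
    finally show ?thesis .
  qed
  have "(\<lambda>n. 2 * c * (1/2) ^ n) \<longlonglongrightarrow> 2 * c * 0"
    by (intro tendsto_intros) auto
  then have null: "(\<lambda>n. 2 * c / 2 ^ n) \<longlonglongrightarrow> 0"
    by (simp add: power_divide)
  have "Cauchy a"
  proof (rule CauchyI')
    fix e :: real assume "0 < e"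
    with null have "\<forall>\<^sub>F n in sequentially. 2 * c / 2 ^ n < e"
      by (rule order_tendstoD(2))
    then obtain N where N: "\<And>n. N \<le> n \<Longrightarrow> 2 * c / 2 ^ n < e"
      by (auto simp: eventually_sequentially)
    show "\<exists>N. \<forall>n\<ge>N. \<forall>j>n. dist (a n) (a j) < e"
    proof (intro exI allI impI)
      fix n j assume "N \<le> n" "n < j"
      then show "dist (a n) (a j) < e"
        using bound[of n j] N[of n] by (simp add: dist_real_def)
    qed
  qed
  then obtain l where l: "a \<longlonglongrightarrow> l"
    using Cauchy_convergent_iff convergent_def by blast
  have "\<bar>l - a n\<bar> \<le> 2 * c / 2 ^ n" for n
  proof (rule LIMSEQ_le_const2)
    show "(\<lambda>j. \<bar>a j - a n\<bar>) \<longlonglongrightarrow> \<bar>l - a n\<bar>" by (intro tendsto_intros l)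
    show "\<exists>N. \<forall>j\<ge>N. \<bar>a j - a n\<bar> \<le> 2 * c / 2 ^ n" using bound by blast
  qed
  with l show ?thesis by blast
qed

lemma Lipschitz_continuous:
  fixes f :: "real \<Rightarrow> real"
  assumes "\<And>s t. \<bar>f s - f t\<bar> \<le> L * \<bar>s - t\<bar>"
  shows "continuous_on A f"
proof -
  have "L \<ge> 0" using assms[of 1 0] by simp
  then have "L-lipschitz_on A f"
    using assms by (intro lipschitz_onI) (auto simp: dist_real_def)
  then show ?thesis by (rule lipschitz_on_continuous_on)
qed

lemma lebesgue_integral_eq_lborel:
  fixes f g :: "'b::euclidean_space \<Rightarrow> real"
  assumes [measurable]: "g \<in> borel_measurable borel" and "AE x in lborel. f x = g x"
  shows "(LINT x|lebesgue. f x) = (LINT x|lborel. g x)"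
proof -
  have g: "g \<in> borel_measurable lebesgue" by (rule measurable_completion) simp
  have ae: "AE x in lebesgue. g x = f x"
    using AE_completion[OF assms(2)] by eventually_elim simp
  have "(LINT x|lebesgue. f x) = (LINT x|lebesgue. g x)"
    by (rule integral_cong_AE) (use g ae borel_measurable_AE[OF g ae] in auto)
  then show ?thesis by (simp add: integral_completion)
qed

text \<open>
  The exceptional set is first enlarged to a Borel null set, because exchanging the order of two
  almost-everywhere quantifiers requires a measurable predicate.
\<close>

lemma AE_lborel_prod_sections:
  fixes Q :: "'b::euclidean_space \<times> 'c::euclidean_space \<Rightarrow> bool"
  assumes "AE p in lborel. Q p"
  shows "AE s in lborel. AE x in lborel. Q (s, x)" "AE x in lborel. AE s in lborel. Q (s, x)"
proof -
  obtain N where N: "N \<in> null_sets lborel" "\<And>p. p \<notin> N \<Longrightarrow> Q p"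
    using assms by (elim AE_E3) auto
  have "AE p in lborel. p \<notin> N" using N(1) by (rule AE_not_in)
  then have "AE p in lborel \<Otimes>\<^sub>M lborel. p \<notin> N" by (simp only: lborel_prod)
  then have *: "AE s in lborel. AE x in lborel. (s, x) \<notin> N" by (rule lborel_pair.AE_pair)
  then show "AE s in lborel. AE x in lborel. Q (s, x)"
    by eventually_elim (use N(2) in \<open>auto elim: eventually_mono\<close>)
  have "{p \<in> space (lborel \<Otimes>\<^sub>M lborel). (fst p, snd p) \<notin> N} = - N"
    by (auto simp: space_pair_measure)
  moreover have "- N \<in> sets (lborel \<Otimes>\<^sub>M lborel)"
    using N(1) by (simp only: lborel_prod) auto
  ultimately have "AE x in lborel. AE s in lborel. (s, x) \<notin> N"
    using * lborel_pair.AE_commute[of "\<lambda>s x. (s, x) \<notin> N"] by simp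
  then show "AE x in lborel. AE s in lborel. Q (s, x)"
    by eventually_elim (use N(2) in \<open>auto elim: eventually_mono\<close>)
qed

text \<open>
  Joint Lebesgue measurability of \<open>v\<close> says nothing about one given time slice or one given
  point. The Borel function \<open>g\<close> has measurable sections everywhere and represents \<open>v\<close> both on almost
  every time slice, as needed for the space integral, and above almost every point, as needed for
  the time integral.
\<close>

lemma Borel_representative:
  fixes v :: "real \<Rightarrow> 'b::euclidean_space \<Rightarrow> real"
  assumes "case_prod v \<in> borel_measurable (lebesgue_on ({0..} \<times> UNIV))"
  obtains g where "case_prod g \<in> borel_measurable (borel \<Otimes>\<^sub>M borel)"
    "AE s in lborel. 0 \<le> s \<longrightarrow> (AE x in lborel. v s x = g s x)"
    "AE x in lborel. AE s in lborel. 0 \<le> s \<longrightarrow> v s x = g s x"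
proof -
  let ?H = "{0..} \<times> UNIV :: (real \<times> 'b) set"
  have "?H \<in> sets lebesgue" by (simp add: closed_Times borel_closed)
  then have "(\<lambda>p. if p \<in> ?H then case_prod v p else 0) \<in> borel_measurable lebesgue"
    using assms by (simp add: borel_measurable_if)
  then obtain g' where g': "g' \<in> borel_measurable lborel"
    "AE p in lborel. (if p \<in> ?H then case_prod v p else 0) = g' p"
    by (elim completion_ex_borel_measurable_real[THEN bexE])
  define g where "g s x = g' (s, x)" for s x
  have "case_prod g \<in> borel_measurable (borel \<Otimes>\<^sub>M borel)"
    using g'(1) by (simp add: g_def[abs_def] borel_prod)
  moreover have "AE s in lborel. 0 \<le> s \<longrightarrow> (AE x in lborel. v s x = g s x)"
    using AE_lborel_prod_sections(1)[OF g'(2)]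
    by eventually_elim (auto simp: g_def elim: eventually_mono)
  moreover have "AE x in lborel. AE s in lborel. 0 \<le> s \<longrightarrow> v s x = g s x"
    using AE_lborel_prod_sections(2)[OF g'(2)]
    by eventually_elim (auto simp: g_def elim: eventually_mono)
  ultimately show thesis by (rule that)
qed

section \<open>Essential bounds\<close>

lemma Linfty_norm_nonneg: "0 \<le> Linfty_norm (f :: 'b::euclidean_space \<Rightarrow> real)"
proof (cases "(\<lambda>x. ereal \<bar>f x\<bar>) \<in> borel_measurable lebesgue")
  case True
  have "(0::ereal) = esssup lebesgue (\<lambda>x::'b. 0)"
    by (rule esssup_const[symmetric]) simp
  also have "\<dots> \<le> Linfty_norm f"
    unfolding Linfty_norm_def by (rule esssup_mono) auto
  finally show ?thesis .
qed (simp add: Linfty_norm_def esssup_non_measurable)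

lemma Linfty_norm_leI:
  fixes f :: "'b::euclidean_space \<Rightarrow> real"
  assumes [measurable]: "f \<in> borel_measurable lebesgue" and "AE x in lebesgue. \<bar>f x\<bar> \<le> c"
  shows "Linfty_norm f \<le> ereal c"
  unfolding Linfty_norm_def using assms(2) by (intro esssup_I) auto

lemma Linfty_norm_AE:
  fixes f :: "'b::euclidean_space \<Rightarrow> real"
  shows "AE x in lebesgue. ereal \<bar>f x\<bar> \<le> Linfty_norm f"
  unfolding Linfty_norm_def by (rule esssup_AE)

lemma Linfty_norm_real:
  assumes "f \<in> Linfty"
  shows "ereal (real_of_ereal (Linfty_norm f)) = Linfty_norm f"
  using assms Linfty_norm_nonneg[of f] by (cases "Linfty_norm f") (auto simp: Linfty_def)

lemma Linfty_AE_bounded: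
  assumes "f \<in> Linfty"
  shows "AE x in lebesgue. \<bar>f x\<bar> \<le> real_of_ereal (Linfty_norm f)"
  using Linfty_norm_AE[of f] Linfty_norm_real[OF assms]
  by (metis (no_types, lifting) eventually_mono ereal_less_eq(3))

text \<open>
  The norm is a continuous function of time by the reverse triangle inequality, and \<open>[0, T]\<close> is
  compact. The norms are extended reals, finite at each time, and are handled through their real values.
\<close>

lemma continuous_Linfty_curve_bounded:
  assumes v: "continuous_Linfty_curve v"
  shows "\<exists>B. \<forall>s\<in>{0..T}. AE x in lebesgue. \<bar>v s x\<bar> \<le> B"
proof -
  define N where "N s = real_of_ereal (Linfty_norm (v s))" for s
  have mem: "v s \<in> Linfty" if "0 \<le> s" for s
    using v that by (simp add: continuous_Linfty_curve_def)
  then have meas: "v s \<in> borel_measurable lebesgue" if "0 \<le> s" for s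
    using that by (simp add: Linfty_def)
  have N_eq: "Linfty_norm (v s) = ereal (N s)" if "0 \<le> s" for s
    unfolding N_def by (rule Linfty_norm_real[OF mem[OF that], symmetric])
  have N_AE: "AE x in lebesgue. \<bar>v s x\<bar> \<le> N s" if "0 \<le> s" for s
    unfolding N_def by (rule Linfty_AE_bounded[OF mem[OF that]])
  have N_le: "N s \<le> c" if "0 \<le> s" "AE x in lebesgue. \<bar>v s x\<bar> \<le> c" for s c
    using Linfty_norm_leI[OF meas that(2)] that(1) by (simp add: N_eq)
  have "continuous_on {0..T} N"
    unfolding continuous_on_def
  proof
    fix t assume t: "t \<in> {0..T}"
    define E where "E s = Linfty_norm (\<lambda>x. v s x - v t x)" for s
    have E: "(E \<longlongrightarrow> 0) (at t within {0..T})"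
      using v t unfolding continuous_Linfty_curve_def E_def
      by (auto intro: tendsto_within_subset)
    then have E_real: "((\<lambda>s. real_of_ereal (E s)) \<longlongrightarrow> 0) (at t within {0..T})"
      using lim_real_of_ereal[of E 0 "at t within {0..T}"] by (simp add: zero_ereal_def)
    have "\<forall>\<^sub>F s in at t within {0..T}. E s < 1"
      using E by (rule order_tendstoD(2)) simp
    moreover have "\<forall>\<^sub>F s in at t within {0..T}. s \<in> {0..T}"
      by (simp add: eventually_at_topological) blast
    ultimately have "\<forall>\<^sub>F s in at t within {0..T}. norm (N s - N t) \<le> real_of_ereal (E s)"
    proof eventually_elim
      case (elim s)
      define e where "e = real_of_ereal (E s)"
      have "E s = ereal e"
        using elim(1) Linfty_norm_nonneg[of "\<lambda>x. v s x - v t x"]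
        unfolding e_def E_def by (cases "Linfty_norm (\<lambda>x. v s x - v t x)") auto
      then have diff: "AE x in lebesgue. \<bar>v s x - v t x\<bar> \<le> e"
        using Linfty_norm_AE[of "\<lambda>x. v s x - v t x"] by (simp add: E_def)
      have "N s \<le> N t + e"
        using elim(2) t N_AE[of t] diff by (intro N_le) (auto elim!: eventually_elim2)
      moreover have "N t \<le> N s + e"
        using elim(2) t N_AE[of s] diff by (intro N_le) (auto elim!: eventually_elim2)
      ultimately show ?case unfolding e_def by simp
    qed
    then have "((\<lambda>s. N s - N t) \<longlongrightarrow> 0) (at t within {0..T})"
      by (rule Lim_null_comparison[OF _ E_real])
    then show "(N \<longlongrightarrow> N t) (at t within {0..T})" by (simp add: LIM_zero_iff)
  qed
  then have "bounded (N ` {0..T})"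
    by (intro compact_imp_bounded compact_continuous_image) auto
  then obtain B where B: "\<And>s. s \<in> {0..T} \<Longrightarrow> \<bar>N s\<bar> \<le> B"
    unfolding bounded_iff by (metis imageI real_norm_def)
  have "AE x in lebesgue. \<bar>v s x\<bar> \<le> B" if "s \<in> {0..T}" for s
    using N_AE[of s] B[OF that] that by (auto elim!: eventually_mono)
  then show ?thesis by blast
qed

text \<open>
  Finiteness from below holds because the space is not a null set.
\<close>

lemma Linfty_esssup:
  fixes f :: "'b::euclidean_space \<Rightarrow> real"
  assumes f: "f \<in> Linfty"
  obtains M where "esssup lebesgue (\<lambda>x. ereal (f x)) = ereal M" "AE x in lebesgue. f x \<le> M"
proof -
  define S where "S = esssup lebesgue (\<lambda>x. ereal (f x))"
  define b where "b = real_of_ereal (Linfty_norm f)"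
  have meas [measurable]: "f \<in> borel_measurable lebesgue" using f by (simp add: Linfty_def)
  have b: "AE x in lebesgue. \<bar>f x\<bar> \<le> b"
    unfolding b_def by (rule Linfty_AE_bounded[OF f])
  have "S \<le> ereal b"
    unfolding S_def by (intro esssup_I) (use b in \<open>auto elim: eventually_mono\<close>)
  moreover have "ereal (- b) \<le> S"
  proof -
    have "ereal (- b) = esssup lebesgue (\<lambda>x::'b. ereal (- b))"
      by (rule esssup_const[symmetric]) simp
    also have "\<dots> \<le> S"
      unfolding S_def by (intro esssup_AE_mono) (use b in \<open>auto elim: eventually_mono\<close>)
    finally show ?thesis .
  qed
  ultimately obtain M where M: "S = ereal M" by (cases S) auto
  moreover have "AE x in lebesgue. f x \<le> M"
    using esssup_AE[of "\<lambda>x. ereal (f x)" lebesgue] M by (simp add: S_def)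
  ultimately show thesis using that by (simp add: S_def)
qed

lemma Linfty_essinf:
  fixes f :: "'b::euclidean_space \<Rightarrow> real"
  assumes f: "f \<in> Linfty"
  obtains m where "essinf lebesgue (\<lambda>x. ereal (f x)) = ereal m" "AE x in lebesgue. m \<le> f x"
proof -
  have "(\<lambda>x. - f x) \<in> Linfty" using f by (simp add: Linfty_def Linfty_norm_def)
  then obtain M where "esssup lebesgue (\<lambda>x. ereal (- f x)) = ereal M" "AE x in lebesgue. - f x \<le> M"
    by (rule Linfty_esssup)
  then show thesis
    by (intro that[of "- M"]) (auto simp: essinf_def elim: eventually_mono)
qed

lemma not_AE_in_bounded:
  fixes C :: "'b::euclidean_space set"
  assumes "bounded C" "C \<in> sets borel"
  shows "\<not> (AE x in lborel. x \<in> C)"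
proof
  assume "AE x in lborel. x \<in> C"
  then have "emeasure lborel C = emeasure lborel (UNIV :: 'b set)"
    using assms(2) by (intro emeasure_eq_AE) auto
  then show False
    using emeasure_bounded_finite[OF assms(1)] by (simp add: emeasure_lborel_UNIV)
qed

section \<open>The nonlocal gain\<close>

locale dispersal =
  fixes k :: "'a::euclidean_space \<Rightarrow> real" and d :: real
  assumes rate_pos: "d > 0"
    and kernel_continuous: "continuous_on UNIV k"
    and kernel_nonneg: "\<And>x. k x \<ge> 0"
    and kernel_mass: "has_bochner_integral lborel k 1"
begin

lemma kernel_measurable [measurable]: "k \<in> borel_measurable borel"
  using kernel_continuous by (rule borel_measurable_continuous_onI)

lemma kernel_reflected: "has_bochner_integral lborel (\<lambda>y. k (x - y)) 1"
proof -
  have "lborel = distr lborel borel (\<lambda>y::'a. x - y)"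
    using lborel_affine[of "-1" x] by (simp add: density_1)
  then have "has_bochner_integral (distr lborel borel (\<lambda>y::'a. x - y)) k 1"
    using kernel_mass by simp
  then show ?thesis
    by (simp add: has_bochner_integral_iff integrable_distr_eq integral_distr)
qed

text \<open>
  The integral of \<open>k (x - y) * v y\<close> over the set where \<open>v\<close> is positive. The positive part
  makes visible that it depends on \<open>v\<close> in a Lipschitz way, although the set of integration jumps.
\<close>

definition gain :: "('a \<Rightarrow> real) \<Rightarrow> 'a \<Rightarrow> real" where
  "gain v x = (LINT y|lborel. k (x - y) * max 0 (v y))"

lemma gain_integrable:
  assumes [measurable]: "v \<in> borel_measurable borel" and "AE y in lborel. v y \<le> M"
  shows "integrable lborel (\<lambda>y. k (x - y) * max 0 (v y))"
proof (rule Bochner_Integration.integrable_bound)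
  show "integrable lborel (\<lambda>y. max 0 M * k (x - y))"
    using kernel_reflected[of x] by (auto simp: has_bochner_integral_iff)
  show "AE y in lborel. norm (k (x - y) * max 0 (v y)) \<le> norm (max 0 M * k (x - y))"
    using assms(2)
  proof eventually_elim
    case (elim y)
    then have "max 0 (v y) \<le> max 0 M" by auto
    then show ?case
      using kernel_nonneg[of "x - y"] by (simp add: abs_mult mult.commute mult_right_mono)
  qed
qed measurable

text \<open>
  The positive part is a contraction and the kernel has mass one. Bounds almost everywhere are enough,
  which is what makes the estimate usable for \<open>L\<^sup>\<infinity>\<close> classes in the uniqueness proof.
\<close>

lemma gain_Lipschitz:
  assumes [measurable]: "v \<in> borel_measurable borel" "w \<in> borel_measurable borel"
    and "AE y in lborel. v y \<le> M" "AE y in lborel. w y \<le> M"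
    and "AE y in lborel. \<bar>v y - w y\<bar> \<le> c"
  shows "\<bar>gain v x - gain w x\<bar> \<le> c"
proof -
  note int = gain_integrable[OF assms(1,3), of x] gain_integrable[OF assms(2,4), of x]
  have "gain v x - gain w x
      = (LINT y|lborel. k (x - y) * max 0 (v y) - k (x - y) * max 0 (w y))"
    unfolding gain_def using int by simp
  also have "\<bar>\<dots>\<bar> \<le> (LINT y|lborel. c * k (x - y))"
  proof (rule integral_abs_AE_bound[OF Bochner_Integration.integrable_diff[OF int]])
    show "AE y in lborel. \<bar>k (x - y) * max 0 (v y) - k (x - y) * max 0 (w y)\<bar> \<le> c * k (x - y)"
      using assms(5)
    proof eventually_elim
      case (elim y)
      then have "\<bar>max 0 (v y) - max 0 (w y)\<bar> \<le> c" by (auto simp: max_def split: if_splits)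
      then show ?case
        using kernel_nonneg[of "x - y"]
        by (simp add: abs_mult mult.commute[of c] mult_left_mono flip: right_diff_distrib)
    qed
  qed (use kernel_reflected[of x] in \<open>auto simp: has_bochner_integral_iff\<close>)
  also have "\<dots> = c"
    using kernel_reflected[of x] by (auto simp: has_bochner_integral_iff)
  finally show ?thesis .
qed

lemma gain_nonneg: "0 \<le> gain v x"
  unfolding gain_def by (intro Bochner_Integration.integral_nonneg) (simp add: kernel_nonneg)

lemma gain_le:
  assumes [measurable]: "v \<in> borel_measurable borel" and "\<And>y. v y \<le> M" "0 \<le> M"
  shows "gain v x \<le> M"
proof -
  have "gain v x \<le> (LINT y|lborel. M * k (x - y))"
    unfolding gain_def
  proof (rule integral_mono)
    show "integrable lborel (\<lambda>y. k (x - y) * max 0 (v y))"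
      by (rule gain_integrable[of _ M]) (auto simp: assms)
    show "k (x - y) * max 0 (v y) \<le> M * k (x - y)" for y
      using assms(2)[of y] assms(3) kernel_nonneg[of "x - y"]
      by (simp add: mult.commute mult_right_mono)
  qed (use kernel_reflected[of x] in \<open>auto simp: has_bochner_integral_iff\<close>)
  also have "\<dots> = M"
    using kernel_reflected[of x] by (auto simp: has_bochner_integral_iff)
  finally show ?thesis .
qed

text \<open>
  Pointwise convergence comes from continuity of \<open>k\<close>. All translates are nonnegative with the same mass,
  so no mass is lost in the limit, and Scheffe's lemma upgrades this to convergence in \<open>L\<^sup>1\<close>.
\<close>

lemma kernel_translation_continuous:
  assumes "X \<longlonglongrightarrow> x"
  shows "(\<lambda>n. LINT y|lborel. \<bar>k (X n - y) - k (x - y)\<bar>) \<longlonglongrightarrow> 0"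
proof -
  have mass: "(\<integral>\<^sup>+ y. norm (k (z - y)) \<partial>lborel) = 1" for z
    using kernel_reflected[of z] kernel_nonneg
    by (subst nn_integral_eq_integral) (auto simp: has_bochner_integral_iff)
  have "(\<lambda>n. \<integral>\<^sup>+ y. norm (k (X n - y) - k (x - y)) \<partial>lborel) \<longlonglongrightarrow> 0"
  proof (rule Scheffe_lemma2)
    have "isCont k z" for z
      using kernel_continuous by (simp add: continuous_on_eq_continuous_at)
    then show "AE y in lborel. (\<lambda>n. k (X n - y)) \<longlonglongrightarrow> k (x - y)"
      by (intro AE_I2 isCont_tendsto_compose[of _ k] tendsto_intros assms)
  qed (use kernel_reflected in \<open>auto simp: has_bochner_integral_iff mass simp del: real_norm_def\<close>)
  then have "(\<lambda>n. ennreal (LINT y|lborel. \<bar>k (X n - y) - k (x - y)\<bar>)) \<longlonglongrightarrow> ennreal 0"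
    using kernel_reflected
    by (subst (asm) nn_integral_eq_integral) (auto simp: has_bochner_integral_iff)
  then show ?thesis
    by (subst (asm) tendsto_ennreal_iff) auto
qed

text \<open>
  The function \<open>v\<close> is only bounded, so all the continuity has to come from the kernel.
\<close>

lemma gain_continuous:
  assumes [measurable]: "v \<in> borel_measurable borel" and "\<And>y. v y \<le> M" "0 \<le> M"
  shows "continuous_on UNIV (gain v)"
  unfolding continuous_on_sequentially comp_def
proof (intro ballI allI impI, elim conjE)
  fix x :: 'a and X assume X: "X \<longlonglongrightarrow> x"
  have int: "integrable lborel (\<lambda>y. k (z - y) * max 0 (v y))" for z
    by (rule gain_integrable[of _ M]) (auto simp: assms)
  have bound: "\<bar>gain v (X n) - gain v x\<bar> \<le> M * (LINT y|lborel. \<bar>k (X n - y) - k (x - y)\<bar>)" for n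
  proof -
    have "gain v (X n) - gain v x
        = (LINT y|lborel. k (X n - y) * max 0 (v y) - k (x - y) * max 0 (v y))"
      unfolding gain_def using int by simp
    also have "\<bar>\<dots>\<bar> \<le> (LINT y|lborel. M * \<bar>k (X n - y) - k (x - y)\<bar>)"
    proof (rule integral_abs_bound_integral[OF Bochner_Integration.integrable_diff[OF int int]])
      show "integrable lborel (\<lambda>y. M * \<bar>k (X n - y) - k (x - y)\<bar>)"
        using kernel_reflected by (auto simp: has_bochner_integral_iff)
      show "\<bar>k (X n - y) * max 0 (v y) - k (x - y) * max 0 (v y)\<bar>
          \<le> M * \<bar>k (X n - y) - k (x - y)\<bar>" for y
        using assms(2)[of y] assms(3)
        by (simp add: abs_mult mult.commute[of M] mult_left_mono flip: left_diff_distrib)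
    qed
    finally show ?thesis by simp
  qed
  have "(\<lambda>n. M * (LINT y|lborel. \<bar>k (X n - y) - k (x - y)\<bar>)) \<longlonglongrightarrow> M * 0"
    by (intro tendsto_intros kernel_translation_continuous X)
  then have lim: "(\<lambda>n. M * (LINT y|lborel. \<bar>k (X n - y) - k (x - y)\<bar>)) \<longlonglongrightarrow> 0"
    by simp
  have "(\<lambda>n. gain v (X n) - gain v x) \<longlonglongrightarrow> 0"
    by (rule Lim_null_comparison[OF _ lim]) (use bound in simp)
  then show "(\<lambda>n. gain v (X n)) \<longlonglongrightarrow> gain v x"
    by (simp add: LIM_zero_iff)
qed

lemma gain_jointly_measurable:
  assumes [measurable]: "case_prod u \<in> borel_measurable (borel \<Otimes>\<^sub>M borel)"
  shows "(\<lambda>p. gain (u (fst p)) (snd p)) \<in> borel_measurable (borel \<Otimes>\<^sub>M borel)"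
  unfolding gain_def by measurable

text \<open>
  The equation \<open>u' = d (gain u - max 0 u)\<close> is equivalent to \<open>u' + d u = d (reaction u)\<close>, since
  \<open>u - max 0 u = min 0 u\<close>. Both terms of this right-hand side are monotone in \<open>u\<close>, which
  is not true of \<open>gain u - max 0 u\<close>.
\<close>

definition reaction :: "('a \<Rightarrow> real) \<Rightarrow> 'a \<Rightarrow> real" where
  "reaction v x = gain v x + min 0 (v x)"

text \<open>
  Above, the gain is at most \<open>M\<close> and the second term is at most zero; below, the gain is
  nonnegative and the second term is at least \<open>m\<close>. The two terms use different ends of the interval, which is
  why it has to contain zero.
\<close>

lemma reaction_bounds:
  assumes [measurable]: "v \<in> borel_measurable borel"
    and "\<And>y. m \<le> v y" "\<And>y. v y \<le> M" "m \<le> 0" "0 \<le> M"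
  shows "m \<le> reaction v x" "reaction v x \<le> M"
proof -
  show "m \<le> reaction v x"
    using gain_nonneg[of v x] assms(2)[of x] assms(4) by (simp add: reaction_def)
  show "reaction v x \<le> M"
    using gain_le[of v M x] assms by (simp add: reaction_def)
qed

lemma reaction_Lipschitz:
  assumes "v \<in> borel_measurable borel" "w \<in> borel_measurable borel"
    and "\<And>y. v y \<le> M" "\<And>y. w y \<le> M" "\<And>y. \<bar>v y - w y\<bar> \<le> c"
  shows "\<bar>reaction v x - reaction w x\<bar> \<le> 2 * c"
proof -
  have "\<bar>gain v x - gain w x\<bar> \<le> c"
    by (rule gain_Lipschitz[of _ _ M]) (use assms in auto)
  moreover have "\<bar>min 0 (v x) - min 0 (w x)\<bar> \<le> c"
    using assms(5)[of x] by (auto simp: min_def split: if_splits)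
  ultimately show ?thesis unfolding reaction_def by linarith
qed

text \<open>
  The space in which the fixed point is found. The Lipschitz constant is the one that the equation forces: the time
  derivative is \<open>d\<close> times a difference of two numbers in \<open>[m, M]\<close>. Unlike mere continuity in time it
  passes to pointwise limits, and it yields continuity into \<open>L\<^sup>\<infinity>\<close>, being uniform in space.
\<close>

definition admissible :: "real \<Rightarrow> real \<Rightarrow> (real \<Rightarrow> 'a \<Rightarrow> real) \<Rightarrow> bool" where
  "admissible m M u \<longleftrightarrow>
     case_prod u \<in> borel_measurable (borel \<Otimes>\<^sub>M borel) \<and>
     (\<forall>t x. m \<le> u t x \<and> u t x \<le> M) \<and>
     (\<forall>s t x. \<bar>u s x - u t x\<bar> \<le> d * (M - m) * \<bar>s - t\<bar>)"

lemma admissibleD: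
  assumes "admissible m M u"
  shows admissible_measurable: "case_prod u \<in> borel_measurable (borel \<Otimes>\<^sub>M borel)"
    and admissible_measurable_space: "u t \<in> borel_measurable borel"
    and admissible_lower: "m \<le> u t x" and admissible_upper: "u t x \<le> M"
    and admissible_Lipschitz: "\<bar>u s x - u t x\<bar> \<le> d * (M - m) * \<bar>s - t\<bar>"
proof -
  show [measurable]: "case_prod u \<in> borel_measurable (borel \<Otimes>\<^sub>M borel)"
    using assms by (simp add: admissible_def)
  show "u t \<in> borel_measurable borel" by measurable
qed (use assms in \<open>auto simp: admissible_def\<close>)

lemma admissible_gain_Lipschitz:
  assumes "admissible m M u"
  shows "\<bar>gain (u s) x - gain (u t) x\<bar> \<le> d * (M - m) * \<bar>s - t\<bar>"
  by (rule gain_Lipschitz[of _ _ M]) (use admissibleD[OF assms] in auto)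

lemma admissible_reaction_continuous:
  assumes "admissible m M u"
  shows "continuous_on A (\<lambda>t. reaction (u t) x)"
  unfolding reaction_def
  by (intro continuous_intros; rule Lipschitz_continuous)
    (use admissible_gain_Lipschitz[OF assms] admissible_Lipschitz[OF assms] in auto)

lemma admissible_reaction_measurable:
  assumes "admissible m M u"
  shows "(\<lambda>p. reaction (u (fst p)) (snd p)) \<in> borel_measurable (borel \<Otimes>\<^sub>M borel)"
proof -
  note [measurable] = admissible_measurable[OF assms] gain_jointly_measurable[OF admissible_measurable[OF assms]]
  show ?thesis unfolding reaction_def by measurable
qed

section \<open>The Duhamel map\<close>

text \<open>
  Variation of constants for \<open>u' + d u = d (reaction u)\<close> with datum \<open>h\<close>. Negative times are mapped to
  zero, so that functions live on the whole time line and estimates need no sign condition on \<open>t\<close>.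
\<close>

definition duhamel :: "('a \<Rightarrow> real) \<Rightarrow> (real \<Rightarrow> 'a \<Rightarrow> real) \<Rightarrow> real \<Rightarrow> 'a \<Rightarrow> real" where
  "duhamel h u t x = exp (- d * max 0 t) *
     (h x + (LBINT s:{0..max 0 t}. d * exp (d * s) * reaction (u s) x))"

lemma duhamel_frozen_past: "duhamel h u (max 0 t) x = duhamel h u t x"
  unfolding duhamel_def by (simp only: max.left_idem)

lemma duhamel_integrable:
  assumes "admissible m M u"
  shows "set_integrable lborel {0..t} (\<lambda>s. d * exp (d * s) * reaction (u s) x)"
  by (intro borel_integrable_atLeastAtMost' continuous_intros admissible_reaction_continuous[OF assms])

text \<open>
  The weights \<open>exp (- d t)\<close> of \<open>h x\<close> and \<open>d * exp (- d (t - s))\<close> of the reaction at time \<open>s\<close> add up to one,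
  so the result is an average of numbers in \<open>[m, M]\<close>.
\<close>

lemma duhamel_bounds:
  assumes u: "admissible m M u" and mM: "m \<le> 0" "0 \<le> M" and h: "\<And>x. m \<le> h x" "\<And>x. h x \<le> M"
  shows "m \<le> duhamel h u t x" "duhamel h u t x \<le> M"
proof -
  define T where "T = max 0 t"
  have T: "0 \<le> T" by (simp add: T_def)
  define I where "I = (LBINT s:{0..T}. d * exp (d * s) * reaction (u s) x)"
  have exp_int: "set_integrable lborel {0..T} (\<lambda>s. (d * c) * exp (d * s))"
    "(LBINT s:{0..T}. (d * c) * exp (d * s)) = c * (exp (d * T) - 1)" for c
    using exp_integral_Icc[of d T "d * c"] T rate_pos by auto
  note R = reaction_bounds[OF admissible_measurable_space[OF u] admissible_lower[OF u] admissible_upper[OF u] mM]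
  have "m * (exp (d * T) - 1) \<le> I"
    unfolding I_def exp_int(2)[symmetric]
    using R(1) rate_pos
    by (intro set_integral_mono exp_int duhamel_integrable[OF u])
      (simp add: mult.assoc mult.left_commute mult_left_mono)
  moreover have "I \<le> M * (exp (d * T) - 1)"
    unfolding I_def exp_int(2)[symmetric]
    using R(2) rate_pos
    by (intro set_integral_mono exp_int duhamel_integrable[OF u])
      (simp add: mult.assoc mult.left_commute mult_left_mono)
  ultimately have "m * exp (d * T) \<le> h x + I" "h x + I \<le> M * exp (d * T)"
    using h(1)[of x] h(2)[of x] by (auto simp: algebra_simps)
  then have "exp (- d * T) * (m * exp (d * T)) \<le> exp (- d * T) * (h x + I)"
    "exp (- d * T) * (h x + I) \<le> exp (- d * T) * (M * exp (d * T))"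
    by (auto intro: mult_left_mono)
  then show "m \<le> duhamel h u t x" "duhamel h u t x \<le> M"
    unfolding duhamel_def I_def T_def[symmetric] by (simp_all add: exp_minus field_simps)
qed

text \<open>
  The one-sided derivative at time zero is included, so that integrating over \<open>[0, t]\<close> recovers the datum.
\<close>

lemma duhamel_derivative:
  assumes u: "admissible m M u" and t: "0 \<le> t"
  shows "((\<lambda>t. duhamel h u t x) has_real_derivative d * (reaction (u t) x - duhamel h u t x))
    (at t within {0..})"
proof -
  let ?f = "\<lambda>s. d * exp (d * s) * reaction (u s) x"
  have cont: "continuous_on {0..t + 1} ?f"
    by (intro continuous_intros admissible_reaction_continuous[OF u])
  have D: "((\<lambda>r. integral {0..r} ?f) has_real_derivative ?f t) (at t within {0..t + 1})"
    by (rule integral_has_real_derivative[OF cont]) (use t in auto)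
  \<comment> \<open>The fundamental theorem of calculus is available on compact intervals; one that extends beyond \<open>t\<close>
    gives the derivative within the half-line.\<close>
  have at_eq: "at t within {0..t + 1} = at t within {0..}"
    by (rule at_within_nhd[of t "{..<t + 1}"]) auto
  have eq: "duhamel h u r x = exp (- d * r) * (h x + integral {0..r} ?f)" if "0 \<le> r" for r
    using that set_borel_integral_eq_integral(2)[OF duhamel_integrable[OF u, of r x]]
    by (simp add: duhamel_def)
  have "((\<lambda>r. exp (- d * r) * (h x + integral {0..r} ?f)) has_real_derivative
      - d * exp (- d * t) * (h x + integral {0..t} ?f) + exp (- d * t) * ?f t)
      (at t within {0..t + 1})"
    by (auto intro!: derivative_eq_intros D)
  also have "- d * exp (- d * t) * (h x + integral {0..t} ?f) + exp (- d * t) * ?f t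
      = d * (reaction (u t) x - duhamel h u t x)"
    using eq[OF t] by (simp add: exp_minus field_simps)
  finally show ?thesis
    unfolding at_eq
    by (rule has_field_derivative_transform_within[where d = 1]) (use t eq in auto)
qed

lemma duhamel_Lipschitz:
  assumes u: "admissible m M u" and mM: "m \<le> 0" "0 \<le> M" and h: "\<And>x. m \<le> h x" "\<And>x. h x \<le> M"
  shows "\<bar>duhamel h u s x - duhamel h u t x\<bar> \<le> d * (M - m) * \<bar>s - t\<bar>"
proof -
  note R = reaction_bounds[OF admissible_measurable_space[OF u] admissible_lower[OF u] admissible_upper[OF u] mM]
  note D = duhamel_bounds[where h = h and x = x, OF u mM h]
  have "\<bar>reaction (u r) x - duhamel h u r x\<bar> \<le> M - m" for r
    using R[of r x] D[of r] by linarith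
  then have "norm (d * (reaction (u r) x - duhamel h u r x)) \<le> d * (M - m)" for r
    using rate_pos by (simp add: abs_mult)
  then have "norm (duhamel h u (max 0 s) x - duhamel h u (max 0 t) x)
      \<le> d * (M - m) * norm (max 0 s - max 0 t)"
    by (intro field_differentiable_bound[OF _ duhamel_derivative[OF u]]) auto
  also have "\<dots> \<le> d * (M - m) * \<bar>s - t\<bar>"
    using mM rate_pos by (intro mult_left_mono) auto
  finally show ?thesis by (simp only: duhamel_frozen_past real_norm_def)
qed
lemma duhamel_admissible:
  assumes u: "admissible m M u" and mM: "m \<le> 0" "0 \<le> M"
    and [measurable]: "h \<in> borel_measurable borel" and h: "\<And>x. m \<le> h x" "\<And>x. h x \<le> M"
  shows "admissible m M (duhamel h u)"
proof -
  note [measurable] = admissible_reaction_measurable[OF u]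
  have [measurable]: "(\<lambda>q. reaction (u (snd q)) (snd (fst q)))
      \<in> borel_measurable ((borel \<Otimes>\<^sub>M borel) \<Otimes>\<^sub>M lborel)"
    using measurable_compose[OF _ admissible_reaction_measurable[OF u],
        of "\<lambda>q. (snd q, snd (fst q))" "(borel \<Otimes>\<^sub>M borel) \<Otimes>\<^sub>M lborel"] by simp
  \<comment> \<open>The domain of integration depends on \<open>t\<close>; written as a conditional it becomes a jointly
    measurable integrand.\<close>
  have "(\<lambda>p. LINT s|lborel. (if 0 \<le> s \<and> s \<le> max 0 (fst p)
        then d * exp (d * s) * reaction (u s) (snd p) else 0))
      \<in> borel_measurable (borel \<Otimes>\<^sub>M borel)"
    by (rule lborel.borel_measurable_lebesgue_integral) (simp add: split_beta')
  also have "(\<lambda>p. LINT s|lborel. (if 0 \<le> s \<and> s \<le> max 0 (fst p)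
        then d * exp (d * s) * reaction (u s) (snd p) else 0))
      = (\<lambda>p. LBINT s:{0..max 0 (fst p)}. d * exp (d * s) * reaction (u s) (snd p))"
    unfolding set_lebesgue_integral_def
    by (intro ext Bochner_Integration.integral_cong) (auto simp: indicator_def)
  finally have [measurable]: "(\<lambda>p. LBINT s:{0..max 0 (fst p)}. d * exp (d * s) * reaction (u s) (snd p))
      \<in> borel_measurable (borel \<Otimes>\<^sub>M borel)" .
  have "case_prod (duhamel h u) \<in> borel_measurable (borel \<Otimes>\<^sub>M borel)"
    unfolding duhamel_def split_beta' by measurable
  then show ?thesis
    unfolding admissible_def
    using duhamel_bounds[where h = h, OF u mM h] duhamel_Lipschitz[where h = h, OF u mM h] by blast
qed

text \<open>
  The factor \<open>2\<close> is the Lipschitz constant of the reaction. Integrating \<open>d * exp (d s)\<close> times \<open>2 c * exp (4 d s)\<close>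
  brings the denominator \<open>5\<close>, and \<open>2 / 5\<close> is below \<open>1 / 2\<close>: an exponential weight that is steep enough beats
  any Lipschitz constant, on the whole half-line at once.
\<close>

lemma duhamel_contraction:
  assumes u: "admissible m M u" and v: "admissible m M v"
    and uv: "\<And>t x. \<bar>u t x - v t x\<bar> \<le> c * exp (4 * d * max 0 t)"
  shows "\<bar>duhamel h u t x - duhamel h v t x\<bar> \<le> c / 2 * exp (4 * d * max 0 t)"
proof -
  define T where "T = max 0 t"
  have T: "0 \<le> T" by (simp add: T_def)
  have "0 \<le> c" using uv[of 0 0] by simp
  let ?I = "\<lambda>u. LBINT s:{0..T}. d * exp (d * s) * reaction (u s) x"
  note int = duhamel_integrable[OF u, of T x] duhamel_integrable[OF v, of T x]
  have "duhamel h u t x - duhamel h v t x = exp (- d * T) * (?I u - ?I v)"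
    unfolding duhamel_def T_def by (simp add: algebra_simps)
  also have "?I u - ?I v
      = (LBINT s:{0..T}. d * exp (d * s) * reaction (u s) x - d * exp (d * s) * reaction (v s) x)"
    using set_integral_diff(2)[OF int] by simp
  finally have 1: "\<bar>duhamel h u t x - duhamel h v t x\<bar> = exp (- d * T) *
      \<bar>LBINT s:{0..T}. d * exp (d * s) * reaction (u s) x - d * exp (d * s) * reaction (v s) x\<bar>"
    by (simp add: abs_mult)
  have "\<bar>LBINT s:{0..T}. d * exp (d * s) * reaction (u s) x - d * exp (d * s) * reaction (v s) x\<bar>
      \<le> (LBINT s:{0..T}. (2 * c * d) * exp ((5 * d) * s))"
  proof (rule set_integral_abs_AE_bound)
    show "set_integrable lborel {0..T} (\<lambda>s. (2 * c * d) * exp ((5 * d) * s))"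
      using T rate_pos by (intro exp_integral_Icc) auto
    show "AE s in lborel. s \<in> {0..T} \<longrightarrow>
      \<bar>d * exp (d * s) * reaction (u s) x - d * exp (d * s) * reaction (v s) x\<bar>
      \<le> (2 * c * d) * exp ((5 * d) * s)"
    proof (intro AE_I2 impI)
      fix s assume s: "s \<in> {0..T}"
      have "\<bar>reaction (u s) x - reaction (v s) x\<bar> \<le> 2 * (c * exp (4 * d * s))"
        by (rule reaction_Lipschitz[of _ _ M])
          (use admissible_measurable_space[OF u] admissible_measurable_space[OF v]
            admissible_upper[OF u] admissible_upper[OF v] uv[of s] s in \<open>simp_all add: max_absorb2\<close>)
      then have "d * exp (d * s) * \<bar>reaction (u s) x - reaction (v s) x\<bar>
          \<le> d * exp (d * s) * (2 * (c * exp (4 * d * s)))"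
        using rate_pos by (intro mult_left_mono) auto
      also have "\<dots> = (2 * c * d) * exp (d * s + 4 * d * s)"
        unfolding exp_add by simp
      also have "d * s + 4 * d * s = (5 * d) * s" by simp
      finally have "d * exp (d * s) * \<bar>reaction (u s) x - reaction (v s) x\<bar>
          \<le> (2 * c * d) * exp ((5 * d) * s)" .
      moreover have "\<bar>d * exp (d * s) * reaction (u s) x - d * exp (d * s) * reaction (v s) x\<bar>
          = d * exp (d * s) * \<bar>reaction (u s) x - reaction (v s) x\<bar>"
        unfolding right_diff_distrib[symmetric] abs_mult using rate_pos by simp
      ultimately show "\<bar>d * exp (d * s) * reaction (u s) x - d * exp (d * s) * reaction (v s) x\<bar>
          \<le> (2 * c * d) * exp ((5 * d) * s)" by simp
    qed
  qed (intro set_integral_diff int)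
  also have "\<dots> = 2 / 5 * c * (exp (5 * d * T) - 1)"
    using exp_integral_Icc(2)[of "5 * d" T "2 * c * d"] T rate_pos by simp
  also have "\<dots> \<le> c / 2 * exp (5 * d * T)"
  proof -
    have "2 / 5 * c * (exp (5 * d * T) - 1) \<le> 2 / 5 * c * exp (5 * d * T)"
      using \<open>0 \<le> c\<close> by (intro mult_left_mono) auto
    also have "\<dots> \<le> c / 2 * exp (5 * d * T)"
      using \<open>0 \<le> c\<close> by (intro mult_right_mono) auto
    finally show ?thesis .
  qed
  finally have "\<bar>duhamel h u t x - duhamel h v t x\<bar> \<le> exp (- d * T) * (c / 2 * exp (5 * d * T))"
    unfolding 1 by (rule mult_left_mono) simp
  moreover have "exp (- d * T) * exp (5 * d * T) = exp (4 * d * T)"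
    by (simp flip: exp_add)
  ultimately have "\<bar>duhamel h u t x - duhamel h v t x\<bar> \<le> c / 2 * exp (4 * d * T)"
    by (metis mult.left_commute)
  then have "\<bar>duhamel h u t x - duhamel h v t x\<bar> \<le> c / 2 * exp (4 * d * max 0 t)"
    by (simp only: T_def)
  then show ?thesis .
qed

text \<open>
  The integrand is continuous in space at each time and uniformly bounded, so dominated
  convergence in time applies along sequences.
\<close>

lemma duhamel_continuous_space:
  assumes u: "admissible m M u" and mM: "m \<le> 0" "0 \<le> M"
    and cont: "\<And>s. continuous_on S (u s)" and h: "continuous_on S h"
  shows "continuous_on S (duhamel h u t)"
proof -
  define T where "T = max 0 t"
  have "continuous_on S (\<lambda>x. LBINT s:{0..T}. d * exp (d * s) * reaction (u s) x)"
    unfolding continuous_on_sequentially comp_def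
  proof (intro ballI allI impI, elim conjE)
    fix x :: 'a and X assume x: "x \<in> S" and X: "\<forall>n::nat. X n \<in> S" "X \<longlonglongrightarrow> x"
    show "(\<lambda>n. LBINT s:{0..T}. d * exp (d * s) * reaction (u s) (X n))
        \<longlonglongrightarrow> (LBINT s:{0..T}. d * exp (d * s) * reaction (u s) x)"
      unfolding set_lebesgue_integral_def
    proof (rule integral_dominated_convergence[where
          w = "\<lambda>s. indicator {0..T} s *\<^sub>R (d * (M - m) * exp (d * s))"])
      show "integrable lborel (\<lambda>s. indicator {0..T} s *\<^sub>R (d * (M - m) * exp (d * s)))"
        using exp_integral_Icc(1)[of d T "d * (M - m)"] rate_pos
        by (simp add: T_def set_integrable_def)
      show "(\<lambda>s. indicator {0..T} s *\<^sub>R (d * exp (d * s) * reaction (u s) z)) \<in> borel_measurable lborel"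
        for z
        using duhamel_integrable[OF u, of T z] by (auto simp: set_integrable_def)
      then show "(\<lambda>s. indicator {0..T} s *\<^sub>R (d * exp (d * s) * reaction (u s) (X n)))
          \<in> borel_measurable lborel" for n .
      show "AE s in lborel. norm (indicator {0..T} s *\<^sub>R (d * exp (d * s) * reaction (u s) (X n)))
          \<le> indicator {0..T} s *\<^sub>R (d * (M - m) * exp (d * s))" for n
      proof (intro AE_I2)
        fix s
        have "\<bar>reaction (u s) (X n)\<bar> \<le> M - m"
          using reaction_bounds[OF admissible_measurable_space[OF u] admissible_lower[OF u] admissible_upper[OF u] mM,
              of s "X n"] mM by linarith
        then have "d * exp (d * s) * \<bar>reaction (u s) (X n)\<bar> \<le> d * exp (d * s) * (M - m)"
          using rate_pos by (intro mult_left_mono) auto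
        then show "norm (indicator {0..T} s *\<^sub>R (d * exp (d * s) * reaction (u s) (X n)))
          \<le> indicator {0..T} s *\<^sub>R (d * (M - m) * exp (d * s))"
          using rate_pos
          by (cases "s \<in> {0..T}") (auto simp: abs_mult mult.assoc mult.commute[of _ "M - m"] mult.left_commute[of _ "M - m"])
      qed
      show "AE s in lborel. (\<lambda>n. indicator {0..T} s *\<^sub>R (d * exp (d * s) * reaction (u s) (X n)))
          \<longlonglongrightarrow> indicator {0..T} s *\<^sub>R (d * exp (d * s) * reaction (u s) x)"
      proof (intro AE_I2)
        fix s
        have "continuous_on UNIV (gain (u s))"
          using admissibleD[OF u] mM by (intro gain_continuous[of _ M]) auto
        then have "continuous_on S (gain (u s))" by (rule continuous_on_subset) simp
        then have "continuous_on S (reaction (u s))"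
          unfolding reaction_def by (intro continuous_intros cont)
        then have "(\<lambda>n. reaction (u s) (X n)) \<longlonglongrightarrow> reaction (u s) x"
          using x X by (auto simp: continuous_on_sequentially comp_def)
        then show "(\<lambda>n. indicator {0..T} s *\<^sub>R (d * exp (d * s) * reaction (u s) (X n)))
          \<longlonglongrightarrow> indicator {0..T} s *\<^sub>R (d * exp (d * s) * reaction (u s) x)"
          by (intro tendsto_intros)
      qed
    qed
  qed
  then show ?thesis
    unfolding duhamel_def T_def by (intro continuous_intros h)
qed

section \<open>The fixed point as a solution\<close>

text \<open>
  Picard iteration started from the datum, held constant in time. The iterates are within the distance
  \<open>M - m\<close> of each other, which starts the geometric decay. The continuity claim is part of this
  statement because it is a property of the iterates that survives the uniform limit in space at each fixed time.
\<close>

lemma duhamel_fixed_point: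
  assumes mM: "m \<le> 0" "0 \<le> M"
    and [measurable]: "h \<in> borel_measurable borel" and h: "\<And>x. m \<le> h x" "\<And>x. h x \<le> M"
  obtains u where "admissible m M u" "\<And>t x. duhamel h u t x = u t x"
    "\<And>S t. continuous_on S h \<Longrightarrow> continuous_on S (u t)"
proof -
  define U where "U n = (duhamel h ^^ n) (\<lambda>t. h)" for n
  have U_0: "U 0 = (\<lambda>t. h)" and U_Suc: "U (Suc n) = duhamel h (U n)" for n
    by (simp_all add: U_def)
  have F: "admissible m M (U n)" for n
  proof (induction n)
    case 0
    have "case_prod (\<lambda>t::real. h) \<in> borel_measurable (borel \<Otimes>\<^sub>M borel)"
      unfolding split_beta' by measurable
    then show ?case
      unfolding U_0 admissible_def using h mM rate_pos by simp
  next
    case (Suc n)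
    then show ?case unfolding U_Suc by (rule duhamel_admissible[OF _ mM]) (use h in auto)
  qed
  have W: "1 \<le> exp (4 * d * max 0 t)" for t
    using rate_pos by simp
  have step: "\<bar>U (Suc n) t x - U n t x\<bar> \<le> (M - m) / 2 ^ n * exp (4 * d * max 0 t)" for n t x
  proof (induction n arbitrary: t x)
    case 0
    have "\<bar>U (Suc 0) t x - U 0 t x\<bar> \<le> (M - m) * 1"
      using admissible_lower[OF F] admissible_upper[OF F] by (smt (verit))
    also have "\<dots> \<le> (M - m) * exp (4 * d * max 0 t)"
      using mM W by (intro mult_left_mono) auto
    finally show ?case by simp
  next
    case (Suc n)
    show ?case
      using duhamel_contraction[OF F F Suc, of h t x] by (simp only: U_Suc) (simp add: mult.commute)
  qed
  have "\<exists>l. (\<lambda>n. U n t x) \<longlonglongrightarrow> l \<and>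
      (\<forall>n. \<bar>l - U n t x\<bar> \<le> 2 * ((M - m) * exp (4 * d * max 0 t)) / 2 ^ n)" for t x
    by (rule geometric_Cauchy_limit) (use step in simp)
  then obtain u where lim: "\<And>t x. (\<lambda>n. U n t x) \<longlonglongrightarrow> u t x"
    and dist: "\<And>n t x. \<bar>u t x - U n t x\<bar> \<le> 2 * ((M - m) * exp (4 * d * max 0 t)) / 2 ^ n"
    by metis
  have u: "admissible m M u"
    unfolding admissible_def
  proof (intro conjI allI)
    show "case_prod u \<in> borel_measurable (borel \<Otimes>\<^sub>M borel)"
      by (rule borel_measurable_LIMSEQ_real[where u = "\<lambda>n. case_prod (U n)"])
        (use lim admissible_measurable[OF F] in auto)
    show "m \<le> u t x" for t x
      by (rule LIMSEQ_le_const[OF lim]) (use admissible_lower[OF F] in auto)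
    show "u t x \<le> M" for t x
      by (rule LIMSEQ_le_const2[OF lim]) (use admissible_upper[OF F] in auto)
    show "\<bar>u s x - u t x\<bar> \<le> d * (M - m) * \<bar>s - t\<bar>" for s t x
      by (rule LIMSEQ_le_const2[OF tendsto_rabs[OF tendsto_diff[OF lim lim]]])
        (use admissible_Lipschitz[OF F] in blast)
  qed
  have null: "(\<lambda>n. c / 2 ^ n) \<longlonglongrightarrow> 0" for c :: real
  proof -
    have "(\<lambda>n. c * (1 / 2) ^ n) \<longlonglongrightarrow> c * 0" by (intro tendsto_intros) auto
    then show ?thesis by (simp add: power_divide)
  qed
  have "duhamel h u t x = u t x" for t x
  proof -
    have "\<bar>duhamel h (U n) t x - duhamel h u t x\<bar> \<le> ((M - m) * exp (4 * d * max 0 t)) / 2 ^ n" for n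
    proof -
      have "\<bar>U n t x - u t x\<bar> \<le> (2 * (M - m) / 2 ^ n) * exp (4 * d * max 0 t)" for t x
        using dist[of t x n] by (simp only: abs_minus_commute mult.assoc times_divide_eq_left)
      moreover have "2 * (M - m) / 2 ^ n / 2 = (M - m) / 2 ^ n" by (simp add: field_simps)
      ultimately show ?thesis
        using duhamel_contraction[OF F u, of n "2 * (M - m) / 2 ^ n" h t x] by simp
    qed
    then have "(\<lambda>n. duhamel h (U n) t x - duhamel h u t x) \<longlonglongrightarrow> 0"
      by (intro Lim_null_comparison[OF _ null] always_eventually) auto
    then have "(\<lambda>n. U (Suc n) t x) \<longlonglongrightarrow> duhamel h u t x"
      unfolding U_Suc by (simp only: LIM_zero_iff)
    then show ?thesis
      using LIMSEQ_Suc[OF lim] LIMSEQ_unique by blast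
  qed
  moreover have "continuous_on S (u t)" if S: "continuous_on S h" for S t
  proof (rule uniform_limit_theorem)
    have "continuous_on S (U n s)" for n s
    proof (induction n arbitrary: s)
      case (Suc n)
      show ?case unfolding U_Suc by (rule duhamel_continuous_space[OF F mM Suc S])
    qed (simp add: U_0 S)
    then show "\<forall>\<^sub>F n in sequentially. continuous_on S (U n t)" by simp
    show "uniform_limit S (\<lambda>n. U n t) (u t) sequentially"
    proof (rule uniform_limitI)
      fix e :: real assume "0 < e"
      with null have "\<forall>\<^sub>F n in sequentially. 2 * ((M - m) * exp (4 * d * max 0 t)) / 2 ^ n < e"
        by (rule order_tendstoD(2))
      then show "\<forall>\<^sub>F n in sequentially. \<forall>x\<in>S. dist (U n t x) (u t x) < e"
      proof eventually_elim
        case (elim n)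
        show ?case
        proof
          fix x
          have "dist (U n t x) (u t x) = \<bar>u t x - U n t x\<bar>"
            by (simp only: dist_real_def abs_minus_commute)
          then show "dist (U n t x) (u t x) < e"
            using dist[of t x n] elim by linarith
        qed
      qed
    qed
  qed simp
  ultimately show thesis using that u by blast
qed

lemma fixed_point_initial:
  assumes "\<And>t x. duhamel h u t x = u t x"
  shows "u 0 x = h x"
proof -
  have "(LBINT s:{0..0}. d * exp (d * s) * reaction (u s) x) = 0"
    unfolding set_lebesgue_integral_def
    by (rule integral_eq_zero_AE, rule AE_I[where N = "{0}"]) (auto simp: indicator_def)
  then show ?thesis
    using assms[of 0 x] by (simp add: duhamel_def)
qed

lemma fixed_point_derivative:
  assumes u: "admissible m M u" and fp: "\<And>t x. duhamel h u t x = u t x" and t: "0 \<le> t"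
  shows "((\<lambda>t. u t x) has_real_derivative d * (gain (u t) x - max 0 (u t x))) (at t within {0..})"
proof -
  have "reaction (u t) x - u t x = gain (u t) x - max 0 (u t x)"
    unfolding reaction_def by (simp add: min_def max_def)
  then show ?thesis
    using duhamel_derivative[OF u t, of h x] by (simp only: fp)
qed

lemma fixed_point_integral:
  assumes u: "admissible m M u" and fp: "\<And>t x. duhamel h u t x = u t x" and t: "0 \<le> t"
  shows "u t x = h x + d * (LBINT s:{0..t}. gain (u s) x) - d * (LBINT s:{0..t}. max 0 (u s x))"
proof -
  have "continuous_on {0..t} (\<lambda>s. u s x)"
    by (rule Lipschitz_continuous) (rule admissible_Lipschitz[OF u])
  then have cont: "continuous_on {0..t} (\<lambda>s. gain (u s) x)" "continuous_on {0..t} (\<lambda>s. max 0 (u s x))"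
    by (auto intro: Lipschitz_continuous[OF admissible_gain_Lipschitz[OF u]] continuous_intros)
  note int = borel_integrable_atLeastAtMost'[OF cont(1)] borel_integrable_atLeastAtMost'[OF cont(2)]
  have "((\<lambda>s. d * (gain (u s) x - max 0 (u s x))) has_integral u t x - u 0 x) {0..t}"
  proof (rule fundamental_theorem_of_calculus[OF t])
    fix s assume "s \<in> {0..t}"
    then show "((\<lambda>s. u s x) has_vector_derivative d * (gain (u s) x - max 0 (u s x))) (at s within {0..t})"
      using fixed_point_derivative[OF u fp, of s x]
      by (auto simp flip: has_real_derivative_iff_has_vector_derivative intro: DERIV_subset)
  qed
  moreover have "((\<lambda>s. d * (gain (u s) x - max 0 (u s x))) has_integral
      d * ((LBINT s:{0..t}. gain (u s) x) - (LBINT s:{0..t}. max 0 (u s x)))) {0..t}"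
    using set_borel_integral_eq_integral[OF int(1)] set_borel_integral_eq_integral[OF int(2)]
    by (intro has_integral_mult_right has_integral_diff) (simp_all add: has_integral_integral)
  ultimately have "u t x - u 0 x
      = d * ((LBINT s:{0..t}. gain (u s) x) - (LBINT s:{0..t}. max 0 (u s x)))"
    by (rule has_integral_unique)
  then show ?thesis
    using fixed_point_initial[OF fp, of x] by (simp add: right_diff_distrib)
qed

text \<open>
  Stated for two functions that agree almost everywhere, so that it applies to slices of a
  solution that is only Lebesgue measurable.
\<close>

lemma positivity_set_integral_eq_gain:
  assumes [measurable]: "w \<in> borel_measurable borel" and "AE y in lborel. v y = w y"
  shows "(LINT y:{y. v y > 0}|lebesgue. k (x - y) * v y) = gain w x"
  unfolding gain_def set_lebesgue_integral_def
proof (rule lebesgue_integral_eq_lborel)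
  show "AE y in lborel. indicator {y. v y > 0} y *\<^sub>R (k (x - y) * v y) = k (x - y) * max 0 (w y)"
    using assms(2) by eventually_elim (auto simp: indicator_def max_def le_less)
qed measurable

text \<open>
  The Borel function \<open>g\<close> may replace \<open>v\<close> under the integrals: in the space integral it has to agree
  with \<open>v\<close> on almost every time slice, in the time integral at almost every time above the given point.
\<close>

lemma integral_equation_at_gain:
  assumes [measurable]: "case_prod g \<in> borel_measurable (borel \<Otimes>\<^sub>M borel)"
    and space: "AE s in lborel. 0 \<le> s \<longrightarrow> (AE y in lborel. v s y = g s y)"
    and time: "AE s in lborel. 0 \<le> s \<longrightarrow> v s x = g s x"
  shows "integral_equation_at d k \<gamma>0 v t x \<longleftrightarrow>
     v t x = \<gamma>0 x + d * (LBINT s:{0..t}. gain (g s) x) - d * (LBINT s:{0..t}. max 0 (g s x))"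
proof -
  have g_space [measurable]: "g s \<in> borel_measurable borel" for s by measurable
  have gain_time [measurable]: "(\<lambda>s. gain (g s) x) \<in> borel_measurable borel"
    using measurable_compose[OF _ gain_jointly_measurable[OF assms(1)], of "\<lambda>s. (s, x)" borel] by simp
  have "(LINT s:{0..t}|lebesgue. (LINT y:{y. v s y > 0}|lebesgue. k (x - y) * v s y))
      = (LBINT s:{0..t}. gain (g s) x)"
    unfolding set_lebesgue_integral_def[where A = "{0..t}"]
  proof (rule lebesgue_integral_eq_lborel)
    show "AE s in lborel. indicator {0..t} s *\<^sub>R (LINT y:{y. v s y > 0}|lebesgue. k (x - y) * v s y)
        = indicator {0..t} s *\<^sub>R gain (g s) x"
      using space
      by eventually_elim (auto simp: indicator_def positivity_set_integral_eq_gain[OF g_space])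
  qed measurable
  moreover have "(LINT s:{0..t}|lebesgue. v s x * indicat_real {y. v s y > 0} x)
      = (LBINT s:{0..t}. max 0 (g s x))"
    unfolding set_lebesgue_integral_def
  proof (rule lebesgue_integral_eq_lborel)
    show "AE s in lborel. indicator {0..t} s *\<^sub>R (v s x * indicat_real {y. v s y > 0} x)
        = indicator {0..t} s *\<^sub>R max 0 (g s x)"
      using time by eventually_elim (auto simp: indicator_def max_def)
  qed measurable
  ultimately show ?thesis unfolding integral_equation_at_def by simp
qed

lemma fixed_point_integral_equation:
  assumes u: "admissible m M u" and "\<And>t x. duhamel h u t x = u t x" and "0 \<le> t"
  shows "integral_equation_at d k h u t x"
  using integral_equation_at_gain[OF admissible_measurable[OF u], of u x h t] fixed_point_integral[OF assms]
  by simp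

text \<open>
  The Lipschitz bound in time is uniform in space, hence a Lipschitz bound in \<open>L\<^sup>\<infinity>\<close>. The datum of
  the solution may be any function in the same class as \<open>h\<close>.
\<close>

lemma fixed_point_classical_solution:
  assumes u: "admissible m M u" and fp: "\<And>t x. duhamel h u t x = u t x"
    and h: "AE x in lebesgue. h x = \<gamma>0 x"
  shows "classical_solution d k \<gamma>0 u"
  unfolding classical_solution_def continuous_Linfty_curve_def
proof (intro conjI allI impI)
  note [measurable] = admissible_measurable_space[OF u]
  have meas [measurable]: "u t \<in> borel_measurable lebesgue" for t
    by (rule measurable_completion) simp
  show "u t \<in> Linfty" for t
  proof -
    have "Linfty_norm (u t) \<le> ereal (\<bar>m\<bar> + \<bar>M\<bar>)"
    proof (intro Linfty_norm_leI AE_I2)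
      show "\<bar>u t x\<bar> \<le> \<bar>m\<bar> + \<bar>M\<bar>" for x
        using admissible_lower[OF u, of t x] admissible_upper[OF u, of t x] by linarith
    qed simp
    also have "\<dots> < \<infinity>" by simp
    finally show ?thesis using meas unfolding Linfty_def by blast
  qed
  show "((\<lambda>s. Linfty_norm (\<lambda>x. u s x - u t x)) \<longlongrightarrow> 0) (at t within {0..})" for t
  proof (rule tendsto_sandwich[where f = "\<lambda>_. 0" and h = "\<lambda>s. ereal (d * (M - m) * \<bar>s - t\<bar>)"])
    have "((\<lambda>s. d * (M - m) * \<bar>s - t\<bar>) \<longlongrightarrow> d * (M - m) * \<bar>t - t\<bar>) (at t within {0..})"
      by (intro tendsto_intros)
    then show "((\<lambda>s. ereal (d * (M - m) * \<bar>s - t\<bar>)) \<longlongrightarrow> 0) (at t within {0..})"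
      by (simp add: zero_ereal_def)
    show "\<forall>\<^sub>F s in at t within {0..}. Linfty_norm (\<lambda>x. u s x - u t x) \<le> ereal (d * (M - m) * \<bar>s - t\<bar>)"
      by (intro always_eventually allI Linfty_norm_leI AE_I2 admissible_Lipschitz[OF u]) measurable
  qed (auto simp: Linfty_norm_nonneg)
  have "case_prod u \<in> borel_measurable lebesgue"
    using admissible_measurable[OF u] by (intro measurable_completion) (simp add: borel_prod)
  then show "case_prod u \<in> borel_measurable (lebesgue_on ({0..} \<times> UNIV))"
    by (rule measurable_restrict_space1)
  show "AE x in lebesgue. u 0 x = \<gamma>0 x"
    using h by (simp add: fixed_point_initial[OF fp])
  show "AE x in lebesgue. integral_equation_at d k \<gamma>0 u t x" if "0 < t" for t
    using h
  proof eventually_elim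
    case (elim x)
    then show ?case
      using fixed_point_integral_equation[OF u fp, of t x] that
      by (simp add: integral_equation_at_def)
  qed
qed

section \<open>Uniqueness\<close>

text \<open>
  The counterpart of the contraction for the integral equation without the exponential factor: two terms, the
  gain and the loss, each with Lipschitz constant one, and \<open>2 d\<close> times the integral of
  \<open>c * exp (4 d s)\<close> is at most \<open>c / 2 * exp (4 d t)\<close>. The hypothesis controls each time slice up to a null set that depends on
  the time; the loss term needs control along the time line above a fixed point, and the exchange of
  the two requires the Borel representative of \<open>v\<close>.
\<close>

lemma classical_solution_contraction:
  assumes v: "classical_solution d k \<gamma>0 v"
    and u: "admissible m M u" "classical_solution d k \<gamma>0 u"
    and dist: "\<And>s. s \<in> {0..T} \<Longrightarrow> AE x in lborel. \<bar>v s x - u s x\<bar> \<le> c * exp (4 * d * s)"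
    and "0 \<le> c" and t: "t \<in> {0..T}"
  shows "AE x in lborel. \<bar>v t x - u t x\<bar> \<le> c / 2 * exp (4 * d * t)"
proof (cases "t = 0")
  case True
  have "AE x in lborel. v 0 x = \<gamma>0 x" "AE x in lborel. u 0 x = \<gamma>0 x"
    using v u(2) by (auto simp: classical_solution_def AE_completion_iff)
  then show ?thesis by eventually_elim (use True \<open>0 \<le> c\<close> in simp)
next
  case False
  with t have t: "0 < t" "t \<in> {0..T}" by auto
  obtain g where g: "case_prod g \<in> borel_measurable (borel \<Otimes>\<^sub>M borel)"
    and space: "AE s in lborel. 0 \<le> s \<longrightarrow> (AE y in lborel. v s y = g s y)"
    and time: "AE x in lborel. AE s in lborel. 0 \<le> s \<longrightarrow> v s x = g s x"
    using v Borel_representative[of v]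
    unfolding classical_solution_def continuous_Linfty_curve_def by blast
  note [measurable] = g admissible_measurable[OF u(1)]
  have [measurable]: "g s \<in> borel_measurable borel" "u s \<in> borel_measurable borel" for s
    by measurable
  have gain_time [measurable]: "(\<lambda>s. gain (g s) x) \<in> borel_measurable borel"
    "(\<lambda>s. gain (u s) x) \<in> borel_measurable borel" for x
    using measurable_compose[OF _ gain_jointly_measurable[OF g], of "\<lambda>s. (s, x)" borel]
      measurable_compose[OF _ gain_jointly_measurable[OF admissible_measurable[OF u(1)]],
        of "\<lambda>s. (s, x)" borel] by auto
  \<comment> \<open>The gain is controlled by whole time slices, the loss by values above a single point.\<close>
  have close_space: "AE s in lborel. s \<in> {0..t} \<longrightarrow>
      (AE x in lborel. \<bar>g s x - u s x\<bar> \<le> c * exp (4 * d * s))"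
    using space
  proof eventually_elim
    case (elim s)
    show ?case
    proof
      assume s: "s \<in> {0..t}"
      then have "AE x in lborel. v s x = g s x" using elim by simp
      moreover have "AE x in lborel. \<bar>v s x - u s x\<bar> \<le> c * exp (4 * d * s)"
        using s t by (intro dist) auto
      ultimately show "AE x in lborel. \<bar>g s x - u s x\<bar> \<le> c * exp (4 * d * s)"
        by eventually_elim simp
    qed
  qed
  have close_time: "AE x in lborel. AE s in lborel. s \<in> {0..t} \<longrightarrow>
      \<bar>g s x - u s x\<bar> \<le> c * exp (4 * d * s)"
  proof -
    have "AE s in lborel. AE x in lborel. s \<in> {0..t} \<longrightarrow> \<bar>g s x - u s x\<bar> \<le> c * exp (4 * d * s)"
      using close_space by eventually_elim auto
    then show ?thesis
      by (subst (asm) lborel_pair.AE_commute) measurable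
  qed
  have exp_le: "c * exp (4 * d * s) \<le> c * exp (4 * d * t)" if "s \<in> {0..t}" for s
    using that rate_pos \<open>0 \<le> c\<close> by (intro mult_left_mono) auto
  have gain_close: "AE s in lborel. s \<in> {0..t} \<longrightarrow>
      \<bar>gain (g s) x - gain (u s) x\<bar> \<le> c * exp (4 * d * s)" for x
    using close_space
  proof eventually_elim
    case (elim s)
    show ?case
    proof
      assume s: "s \<in> {0..t}"
      then have close: "AE y in lborel. \<bar>g s y - u s y\<bar> \<le> c * exp (4 * d * s)"
        using elim by simp
      then have "AE y in lborel. g s y \<le> M + c * exp (4 * d * s)"
        by eventually_elim (use admissible_upper[OF u(1), of s] in \<open>smt (verit)\<close>)
      moreover have "u s y \<le> M + c * exp (4 * d * s)" for y
        using admissible_upper[OF u(1), of s y] \<open>0 \<le> c\<close> by (simp add: add_increasing2)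
      ultimately show "\<bar>gain (g s) x - gain (u s) x\<bar> \<le> c * exp (4 * d * s)"
        using close by (intro gain_Lipschitz[where M = "M + c * exp (4 * d * s)"]) auto
    qed
  qed
  have integrals_close: "\<bar>(LBINT s:{0..t}. f s) - (LBINT s:{0..t}. f' s)\<bar>
      \<le> c * (exp (4 * d * t) - 1) / (4 * d)"
    if [measurable]: "f \<in> borel_measurable borel" "f' \<in> borel_measurable borel"
      and f': "\<And>s. \<bar>f' s\<bar> \<le> \<bar>m\<bar> + \<bar>M\<bar>"
      and close: "AE s in lborel. s \<in> {0..t} \<longrightarrow> \<bar>f s - f' s\<bar> \<le> c * exp (4 * d * s)"
    for f f' :: "real \<Rightarrow> real"
  proof -
    have "AE s in lborel. s \<in> {0..t} \<longrightarrow> \<bar>f s\<bar> \<le> \<bar>m\<bar> + \<bar>M\<bar> + c * exp (4 * d * t)"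
      using close by eventually_elim (use f' exp_le in \<open>smt (verit)\<close>)
    then have int: "set_integrable lborel {0..t} f" "set_integrable lborel {0..t} f'"
      by (rule set_integrable_bounded_Icc[rotated], measurable)
        (rule set_integrable_bounded_Icc[where B = "\<bar>m\<bar> + \<bar>M\<bar>"], use f' in auto)
    have "(LBINT s:{0..t}. f s) - (LBINT s:{0..t}. f' s) = (LBINT s:{0..t}. f s - f' s)"
      using set_integral_diff(2)[OF int] by simp
    also have "\<bar>\<dots>\<bar> \<le> (LBINT s:{0..t}. c * exp ((4 * d) * s))"
      using close t rate_pos
      by (intro set_integral_abs_AE_bound set_integral_diff int exp_integral_Icc) auto
    also have "\<dots> = c * (exp (4 * d * t) - 1) / (4 * d)"
      using t rate_pos by (intro exp_integral_Icc) auto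
    finally show ?thesis .
  qed
  have eq: "AE x in lborel. integral_equation_at d k \<gamma>0 v t x"
    "AE x in lborel. integral_equation_at d k \<gamma>0 u t x"
    using v u(2) t by (auto simp: classical_solution_def AE_completion_iff)
  from eq time close_time show ?thesis
  proof eventually_elim
    case (elim x)
    define I J where "I = (LBINT s:{0..t}. gain (g s) x) - (LBINT s:{0..t}. gain (u s) x)"
      and "J = (LBINT s:{0..t}. max 0 (g s x)) - (LBINT s:{0..t}. max 0 (u s x))"
    have "\<bar>I\<bar> \<le> c * (exp (4 * d * t) - 1) / (4 * d)"
      unfolding I_def
    proof (rule integrals_close[OF gain_time _ gain_close])
      have "gain (u s) x \<le> max 0 M" for s
        using admissible_upper[OF u(1), of s] by (intro gain_le) (auto simp: max.coboundedI2)
      then show "\<bar>gain (u s) x\<bar> \<le> \<bar>m\<bar> + \<bar>M\<bar>" for s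
        using gain_nonneg[of "u s" x] by (smt (verit))
    qed
    moreover have "\<bar>J\<bar> \<le> c * (exp (4 * d * t) - 1) / (4 * d)"
      unfolding J_def
    proof (rule integrals_close)
      show "\<bar>max 0 (u s x)\<bar> \<le> \<bar>m\<bar> + \<bar>M\<bar>" for s
        using admissible_upper[OF u(1), of s x] by auto
      show "AE s in lborel. s \<in> {0..t} \<longrightarrow>
          \<bar>max 0 (g s x) - max 0 (u s x)\<bar> \<le> c * exp (4 * d * s)"
        using elim(4) by eventually_elim (auto simp: max_def)
    qed measurable
    ultimately have "\<bar>I - J\<bar> \<le> 2 * (c * (exp (4 * d * t) - 1) / (4 * d))" by linarith
    then have "d * \<bar>I - J\<bar> \<le> d * (2 * (c * (exp (4 * d * t) - 1) / (4 * d)))"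
      using rate_pos by (intro mult_left_mono) auto
    also have "\<dots> = c / 2 * (exp (4 * d * t) - 1)"
      using rate_pos by (simp add: field_simps)
    also have "\<dots> \<le> c / 2 * exp (4 * d * t)"
      using \<open>0 \<le> c\<close> by (intro mult_left_mono) auto
    finally have bound: "d * \<bar>I - J\<bar> \<le> c / 2 * exp (4 * d * t)" .
    have "v t x - u t x = d * (I - J)"
      using elim(1,2) integral_equation_at_gain[OF g space elim(3), of \<gamma>0 t]
        integral_equation_at_gain[OF admissible_measurable[OF u(1)], of u x \<gamma>0 t]
      by (simp add: I_def J_def right_diff_distrib)
    then have "\<bar>v t x - u t x\<bar> = d * \<bar>I - J\<bar>"
      using rate_pos by (simp add: abs_mult)
    with bound show ?case by simp
  qed
qed

text \<open>
  Both curves are bounded on \<open>[0, t]\<close>, which gives a first bound with the exponential weight; it can be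
  halved indefinitely.
\<close>

lemma classical_solution_unique:
  assumes v: "classical_solution d k \<gamma>0 v"
    and u: "admissible m M u" "classical_solution d k \<gamma>0 u" and t: "0 \<le> t"
  shows "AE x in lebesgue. v t x = u t x"
proof -
  obtain B where B: "\<forall>s\<in>{0..t}. AE x in lborel. \<bar>v s x\<bar> \<le> B"
    using v continuous_Linfty_curve_bounded[of v t]
    by (auto simp: classical_solution_def AE_completion_iff)
  define c where "c = \<bar>B\<bar> + \<bar>m\<bar> + \<bar>M\<bar>"
  have "\<forall>s\<in>{0..t}. AE x in lborel. \<bar>v s x - u s x\<bar> \<le> c / 2 ^ n * exp (4 * d * s)" for n
  proof (induction n)
    case 0
    show ?case
    proof
      fix s assume s: "s \<in> {0..t}"
      then have "c * 1 \<le> c * exp (4 * d * s)"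
        using rate_pos by (intro mult_left_mono) (auto simp: c_def)
      moreover have "AE x in lborel. \<bar>v s x - u s x\<bar> \<le> c"
        using bspec[OF B s]
      proof eventually_elim
        case (elim x)
        then show ?case
          using admissible_lower[OF u(1), of s x] admissible_upper[OF u(1), of s x]
          unfolding c_def by linarith
      qed
      ultimately show "AE x in lborel. \<bar>v s x - u s x\<bar> \<le> c / 2 ^ 0 * exp (4 * d * s)"
        by (auto elim!: eventually_mono)
    qed
  next
    case (Suc n)
    show ?case
    proof
      fix s assume "s \<in> {0..t}"
      then show "AE x in lborel. \<bar>v s x - u s x\<bar> \<le> c / 2 ^ Suc n * exp (4 * d * s)"
        using classical_solution_contraction[OF v u, of t "c / 2 ^ n" s] Suc
        by (simp add: c_def mult.commute)
    qed
  qed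
  then have "AE x in lborel. \<forall>n. \<bar>v t x - u t x\<bar> \<le> c / 2 ^ n * exp (4 * d * t)"
    using t by (subst AE_all_countable) auto
  then have "AE x in lborel. v t x = u t x"
  proof eventually_elim
    case (elim x)
    have "(\<lambda>n. c * exp (4 * d * t) * (1 / 2) ^ n) \<longlonglongrightarrow> c * exp (4 * d * t) * 0"
      by (intro tendsto_intros) auto
    moreover have "\<bar>v t x - u t x\<bar> \<le> c * exp (4 * d * t) * (1 / 2) ^ n" for n
      using elim by (simp add: power_divide)
    ultimately have "\<bar>v t x - u t x\<bar> \<le> c * exp (4 * d * t) * 0"
      by (intro LIMSEQ_le_const) auto
    then show ?case by simp
  qed
  then show ?thesis by (simp add: AE_completion_iff)
qed

end

section \<open>Well-posedness\<close>

theorem theorem1p1: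
  fixes d l0 :: real
    and k \<gamma>0 :: "real ^ 'n \<Rightarrow> real"
    and \<Omega>0 :: "(real ^ 'n) set"
  assumes "d > 0"
    and "continuous_on UNIV k" and "k \<in> Linfty"
    and "\<And>x. k x \<ge> 0" and "k 0 > 0"
    and "has_bochner_integral lebesgue k 1"
    and "smooth_bounded_domain \<Omega>0"
    and "l0 > 0"
    and "\<gamma>0 \<in> Linfty"
    and "AE x in lebesgue. x \<notin> closure \<Omega>0 \<longrightarrow> \<gamma>0 x = - l0"
    and "AE x in lebesgue. x \<in> closure \<Omega>0 \<longrightarrow> \<gamma>0 x \<ge> 0"
    and "\<not> (AE x in lebesgue. x \<in> closure \<Omega>0 \<longrightarrow> \<gamma>0 x = 0)"
  shows "\<exists>\<gamma>. classical_solution d k \<gamma>0 \<gamma> \<and>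
    (\<forall>\<gamma>'. classical_solution d k \<gamma>0 \<gamma>' \<longrightarrow>
       (\<forall>t\<ge>0. AE x in lebesgue. \<gamma>' t x = \<gamma> t x)) \<and>
    (\<forall>t>0. \<forall>x. ((\<lambda>s. \<gamma> s x) has_real_derivative
       d * (LINT y:{y. \<gamma> t y > 0}|lebesgue. k (x - y) * \<gamma> t y)
         - d * \<gamma> t x * indicat_real {y. \<gamma> t y > 0} x) (at t)) \<and>
    (\<forall>t>0. AE x in lebesgue.
       essinf lebesgue (\<lambda>z. ereal (\<gamma>0 z)) \<le> ereal (\<gamma> t x) \<and>
       ereal (\<gamma> t x) \<le> esssup lebesgue (\<lambda>z. ereal (\<gamma>0 z))) \<and>
    (\<forall>g. continuous_on (closure \<Omega>0) g \<and>
         (AE x in lebesgue. x \<in> closure \<Omega>0 \<longrightarrow> \<gamma>0 x = g x) \<longrightarrow>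
       (\<exists>\<gamma>'. (\<forall>t\<ge>0. AE x in lebesgue. \<gamma>' t x = \<gamma> t x) \<and>
          pointwise_solution d k (\<lambda>x. if x \<in> closure \<Omega>0 then g x else - l0) \<gamma>' \<and>
          (\<forall>t>0. continuous_on (closure \<Omega>0) (\<gamma>' t) \<and>
                 continuous_on (- closure \<Omega>0) (\<gamma>' t))))"
proof -
  have k_meas: "k \<in> borel_measurable borel"
    using assms(2) by (rule borel_measurable_continuous_onI)
  interpret dispersal k d
  proof
    show "has_bochner_integral lborel k 1"
      using assms(6) k_meas
      by (simp add: has_bochner_integral_iff integrable_completion integral_completion)
  qed (use assms in auto)
  let ?C = "closure \<Omega>0"
  have C_bounded: "bounded ?C" and C_closed: "closed ?C"
    using assms(7) by (auto simp: smooth_bounded_domain_def bounded_closure)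
  then have C_compact: "compact ?C" by (simp add: compact_eq_bounded_closed)
  have C_borel: "?C \<in> sets borel" using C_closed by (rule borel_closed)
  obtain M where M: "esssup lebesgue (\<lambda>x. ereal (\<gamma>0 x)) = ereal M" "AE x in lebesgue. \<gamma>0 x \<le> M"
    using assms(9) by (rule Linfty_esssup)
  obtain m where m: "essinf lebesgue (\<lambda>x. ereal (\<gamma>0 x)) = ereal m" "AE x in lebesgue. m \<le> \<gamma>0 x"
    using assms(9) by (rule Linfty_essinf)
  \<comment> \<open>The datum is nonnegative on the closed domain, and the closed domain is not a null set,
    since the datum does not vanish almost everywhere there.\<close>
  have M_nonneg: "0 \<le> M"
  proof (rule ccontr)
    assume "\<not> 0 \<le> M"
    with M(2) assms(11) have "AE x in lebesgue. x \<in> ?C \<longrightarrow> \<gamma>0 x = 0"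
      by (auto elim!: eventually_elim2)
    with assms(12) show False by contradiction
  qed
  \<comment> \<open>The datum is negative outside a bounded set.\<close>
  have m_nonpos: "m \<le> 0"
  proof (rule ccontr)
    assume "\<not> m \<le> 0"
    with m(2) assms(8,10) have "AE x in lebesgue. x \<in> ?C"
      by (auto elim!: eventually_elim2)
    then show False
      using not_AE_in_bounded[OF C_bounded C_borel] by (simp add: AE_completion_iff)
  qed
  obtain h0 where h0: "h0 \<in> borel_measurable lborel" "AE x in lborel. \<gamma>0 x = h0 x"
    using assms(9) completion_ex_borel_measurable_real[of \<gamma>0 lborel] unfolding Linfty_def by blast
  \<comment> \<open>Clamping the Borel representative makes the essential bounds hold at every point, which
    the invariance of the interval requires.\<close>
  define h where "h x = max m (min M (h0 x))" for x
  have h_meas: "h \<in> borel_measurable borel" using h0(1) unfolding h_def[abs_def] by simp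
  have h_bounds: "m \<le> h x" "h x \<le> M" for x
    using M_nonneg m_nonpos by (auto simp: h_def)
  have h_AE: "AE x in lebesgue. h x = \<gamma>0 x"
    using M(2) m(2) AE_completion[OF h0(2)] by eventually_elim (simp add: h_def)
  obtain u where u: "admissible m M u" and u_fp: "\<And>t x. duhamel h u t x = u t x"
    by (rule duhamel_fixed_point[OF m_nonpos M_nonneg h_meas h_bounds]) (rule that)
  have u_sol: "classical_solution d k \<gamma>0 u"
    by (rule fixed_point_classical_solution[OF u u_fp h_AE])
  show ?thesis
  proof (rule exI[of _ u], intro conjI allI impI)
    show "classical_solution d k \<gamma>0 u" by (rule u_sol)
    show "AE x in lebesgue. v t x = u t x" if "classical_solution d k \<gamma>0 v" "0 \<le> t" for v t
      using classical_solution_unique[OF that(1) u u_sol that(2)] .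
    show "((\<lambda>s. u s x) has_real_derivative
        d * (LINT y:{y. u t y > 0}|lebesgue. k (x - y) * u t y)
          - d * u t x * indicat_real {y. u t y > 0} x) (at t)" if "0 < t" for t x
    proof -
      have "at t within {0..} = at t"
        using that by (intro at_within_interior) auto
      moreover have "(LINT y:{y. u t y > 0}|lebesgue. k (x - y) * u t y) = gain (u t) x"
        by (rule positivity_set_integral_eq_gain[OF admissible_measurable_space[OF u]]) simp
      moreover have "u t x * indicat_real {y. u t y > 0} x = max 0 (u t x)"
        by (auto simp: indicator_def max_def le_less)
      ultimately show ?thesis
        using fixed_point_derivative[OF u u_fp, of t x] that
        by (simp add: right_diff_distrib mult.assoc)
    qed
    show "AE x in lebesgue. essinf lebesgue (\<lambda>z. ereal (\<gamma>0 z)) \<le> ereal (u t x) \<and>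
       ereal (u t x) \<le> esssup lebesgue (\<lambda>z. ereal (\<gamma>0 z))" for t
      using admissible_lower[OF u] admissible_upper[OF u] by (simp add: M(1) m(1))
  next
    fix g assume g: "continuous_on ?C g \<and> (AE x in lebesgue. x \<in> ?C \<longrightarrow> \<gamma>0 x = g x)"
    \<comment> \<open>The same construction from the piecewise continuous representative of the datum gives another
      classical solution of the same problem, so it agrees with the first one almost everywhere.\<close>
    define h' where "h' = (\<lambda>x. if x \<in> ?C then g x else - l0)"
    have "bounded (g ` ?C)"
      using g C_compact by (intro compact_imp_bounded compact_continuous_image) auto
    then obtain B where B: "\<And>x. x \<in> ?C \<Longrightarrow> \<bar>g x\<bar> \<le> B"
      unfolding bounded_iff by (metis imageI real_norm_def)
    have h'_meas: "h' \<in> borel_measurable borel"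
      unfolding h'_def using g C_borel by (intro borel_measurable_continuous_on_if) auto
    have h'_bounds: "- (\<bar>B\<bar> + l0) \<le> h' x" "h' x \<le> \<bar>B\<bar> + l0" for x
      using B[of x] assms(8) by (auto simp: h'_def)
    have h'_AE: "AE x in lebesgue. h' x = \<gamma>0 x"
      using conjunct2[OF g] assms(10) by eventually_elim (auto simp: h'_def)
    have B_signs: "- (\<bar>B\<bar> + l0) \<le> 0" "0 \<le> \<bar>B\<bar> + l0" using assms(8) by auto
    obtain w where w: "admissible (- (\<bar>B\<bar> + l0)) (\<bar>B\<bar> + l0) w"
      and w_fp: "\<And>t x. duhamel h' w t x = w t x"
      and w_cont: "\<And>S t. continuous_on S h' \<Longrightarrow> continuous_on S (w t)"
      by (rule duhamel_fixed_point[OF B_signs h'_meas h'_bounds]) (rule that)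
    have w_sol: "classical_solution d k \<gamma>0 w"
      by (rule fixed_point_classical_solution[OF w w_fp h'_AE])
    have "pointwise_solution d k h' w"
      unfolding pointwise_solution_def
    proof (intro conjI allI impI)
      show "w 0 x = h' x" for x by (rule fixed_point_initial[OF w_fp])
      show "continuous_on {0..} (\<lambda>t. w t x)" for x
        by (rule Lipschitz_continuous) (rule admissible_Lipschitz[OF w])
      show "integral_equation_at d k h' w t x" if "0 < t" for t x
        using that by (intro fixed_point_integral_equation[OF w w_fp]) simp
    qed
    moreover have "continuous_on ?C h'"
      using conjunct1[OF g] by (rule continuous_on_eq) (simp add: h'_def)
    moreover have "continuous_on (- ?C) h'"
      by (rule continuous_on_eq[OF continuous_on_const[of _ "- l0"]]) (simp add: h'_def)
    moreover have "AE x in lebesgue. w t x = u t x" if "0 \<le> t" for t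
      using classical_solution_unique[OF w_sol u u_sol that] .
    ultimately show "\<exists>\<gamma>'. (\<forall>t\<ge>0. AE x in lebesgue. \<gamma>' t x = u t x) \<and>
        pointwise_solution d k (\<lambda>x. if x \<in> ?C then g x else - l0) \<gamma>' \<and>
        (\<forall>t>0. continuous_on ?C (\<gamma>' t) \<and> continuous_on (- ?C) (\<gamma>' t))"
      unfolding h'_def[symmetric] using w_cont by blast
  qed
qed

end
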